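(* In the model with gas fees described in the context (with $\gamma>0$, $\delta>0$, $\lambda>0$, $P>0$), the instantaneous rate of the gas fees that go to validators, $\overline{\mathsf{GAS}}:=\lambda(g_+\pi_++g_-\pi_-)$, is given by $$ \overline{\mathsf{GAS}}=K_\lambda\cdot G, $$ where $$ K_\lambda=\frac{\lambda}{1+(\gamma+\delta)\sqrt{2\lambda}/\sigma+\lambda((\gamma+\delta)^2-\gamma^2)/\sigma^2}, $$ $$ G=\frac{P\{x^*(Pe^{-\gamma-\delta})-x^*(Pe^{-\gamma})\}}{2}+\frac{e^{+\gamma}\{y^*(Pe^{-\gamma-\delta})-y^*(Pe^{-\gamma})\}}{2}+\frac{Pe^{+\gamma}\{x^*(Pe^{+\gamma+\delta})-x^*(Pe^{+\gamma})\}}{2}+\frac{y^*(Pe^{+\gamma+\delta})-y^*(Pe^{+\gamma})}{2}. $$ Moreover, in the limit $\lambda\to\infty$ (other parameters fixed), the first factor satisfies $$ \lim_{\lambda\to\infty}K_\lambda=\frac{\sigma^2}{(\gamma+\delta)^2-\gamma^2}, $$ and separately, for small gas fees, i.e. as $\delta\to0^+$ (with $P,\gamma$ and the pool fixed), the second factor satisfies $$ G=\frac{P\delta^2}{2}\cdot\frac{y^{*\prime}(Pe^{-\gamma})+e^{+\gamma}\,y^{*\prime}(Pe^{+\gamma})}{2}+o(\delta^2). $$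
   Context: Mispricing process with gas fees. Fix $\sigma,\lambda,\gamma,\delta>0$, $\bar\gamma=\gamma+\delta$. The process $z_t$ satisfies $dz_t=\sigma\,dB_t$ ($B$ standard Brownian motion) between the arrival times of an independent Poisson process of rate $\lambda$; at an arrival time $t$: if $z_{t^-}>\bar\gamma$ then $z_t=\gamma$; if $z_{t^-}<-\bar\gamma$ then $z_t=-\gamma$; otherwise $z_t=z_{t^-}$. It has a unique invariant distribution $\pi$; $\pi_+=\pi((\bar\gamma,\infty))$ and $\pi_-=\pi((-\infty,-\bar\gamma))$, and with $\eta=\sqrt{2\lambda}\bar\gamma/\sigma$ one has $\pi_+=\pi_-=\frac{1}{2+2\eta+\eta^2(1-(\gamma/(\gamma+\delta))^2)}$. Pool. $f:\mathbb{R}_+^2\to\mathbb{R}$ is a bonding function and $L\in\mathbb{R}$; $V(P)=\min\{Px+y:(x,y)\in\mathbb{R}^2_+,\ f(x,y)=L\}$. Assume an optimal solution $(x^*(P),y^*(P))$ exists for every $P\ge0$ and $V$ is everywhere twice continuously differentiable. Primes denote derivatives in price. Gas costs valued in the numéraire: $g_+=P\{x^*(Pe^{-\gamma-\delta})-x^*(Pe^{-\gamma})\}+e^{\gamma}\{y^*(Pe^{-\gamma-\delta})-y^*(Pe^{-\gamma})\}$, $g_-=e^{\gamma}P\{x^*(Pe^{\gamma+\delta})-x^*(Pe^{\gamma})\}+\{y^*(Pe^{\gamma+\delta})-y^*(Pe^{\gamma})\}$. *)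

theory Defs
  imports "HOL-Probability.Probability" "HOL-Library.Landau_Symbols"
begin

definition brownian_motion :: "'a measure \<Rightarrow> (real \<Rightarrow> 'a \<Rightarrow> real) \<Rightarrow> bool" where
  "brownian_motion M B \<longleftrightarrow>
     prob_space M \<and>
     (\<forall>t\<ge>0. B t \<in> borel_measurable M) \<and>
     (AE \<omega> in M. B 0 \<omega> = 0) \<and>
     (AE \<omega> in M. continuous_on {0..} (\<lambda>t. B t \<omega>)) \<and>
     (\<forall>s t. 0 \<le> s \<and> s < t \<longrightarrow>
        distributed M lborel (\<lambda>\<omega>. B t \<omega> - B s \<omega>) (normal_density 0 (sqrt (t - s)))) \<and>
     (\<forall>ts :: nat \<Rightarrow> real. 0 \<le> ts 0 \<and> incseq ts \<longrightarrow>
        prob_space.indep_vars M (\<lambda>_. borel) (\<lambda>i \<omega>. B (ts (Suc i)) \<omega> - B (ts i) \<omega>) UNIV)"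

text \<open>\<open>\<tau> n\<close> is the arrival time number \<open>n + 1\<close> of a Poisson process of rate \<open>r\<close> started at time 0:
  the waiting times are independent and exponentially distributed with parameter \<open>r\<close>.\<close>

definition poisson_arrivals :: "'a measure \<Rightarrow> real \<Rightarrow> (nat \<Rightarrow> 'a \<Rightarrow> real) \<Rightarrow> bool" where
  "poisson_arrivals M r \<tau> \<longleftrightarrow>
     (let gap = (\<lambda>n \<omega>. case n of 0 \<Rightarrow> \<tau> 0 \<omega> | Suc k \<Rightarrow> \<tau> (Suc k) \<omega> - \<tau> k \<omega>) in
        prob_space M \<and>
        (\<forall>n. distributed M lborel (gap n) (exponential_density r)) \<and>
        prob_space.indep_vars M (\<lambda>_. borel) gap UNIV)"

text \<open>One sample path \<open>\<zeta>\<close>, driven by the path \<open>w\<close> and the set \<open>T\<close> of arrival times. The first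
  clause is \<open>d\<zeta> = \<sigma> dw\<close> between arrivals; the interval may start at an arrival (paths are
  right-continuous there) but may not contain a later one.\<close>

definition mispricing_path ::
  "real \<Rightarrow> real \<Rightarrow> real \<Rightarrow> (real \<Rightarrow> real) \<Rightarrow> real set \<Rightarrow> (real \<Rightarrow> real) \<Rightarrow> bool" where
  "mispricing_path \<sigma> \<gamma> \<delta> w T \<zeta> \<longleftrightarrow>
     (\<forall>s t. 0 \<le> s \<and> s \<le> t \<and> {s<..t} \<inter> T = {} \<longrightarrow> \<zeta> t - \<zeta> s = \<sigma> * (w t - w s)) \<and>
     (\<forall>t\<in>T. \<exists>l. (\<zeta> \<longlongrightarrow> l) (at_left t) \<and>
        \<zeta> t = (if l > \<gamma> + \<delta> then \<gamma> else if l < - (\<gamma> + \<delta>) then - \<gamma> else l))"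

text \<open>\<open>z x\<close> is the mispricing process started from \<open>z\<^sub>0 = x\<close>.\<close>

definition mispricing_process ::
  "real \<Rightarrow> real \<Rightarrow> real \<Rightarrow> real \<Rightarrow> 'a measure \<Rightarrow> (real \<Rightarrow> 'a \<Rightarrow> real) \<Rightarrow> (nat \<Rightarrow> 'a \<Rightarrow> real) \<Rightarrow>
    (real \<Rightarrow> real \<Rightarrow> 'a \<Rightarrow> real) \<Rightarrow> bool" where
  "mispricing_process \<sigma> r \<gamma> \<delta> M B \<tau> z \<longleftrightarrow>
     brownian_motion M B \<and> poisson_arrivals M r \<tau> \<and>
     prob_space.indep_set M
       (sets (vimage_algebra (space M) (\<lambda>\<omega>. \<lambda>t\<in>{0..}. B t \<omega>) (PiM {0..} (\<lambda>_. borel))))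
       (sets (vimage_algebra (space M) (\<lambda>\<omega> n. \<tau> n \<omega>) (PiM UNIV (\<lambda>_. borel)))) \<and>
     (\<forall>x. (\<forall>t\<ge>0. z x t \<in> borel_measurable M) \<and>
          (AE \<omega> in M. z x 0 \<omega> = x \<and>
             mispricing_path \<sigma> \<gamma> \<delta> (\<lambda>t. B t \<omega>) (range (\<lambda>n. \<tau> n \<omega>)) (\<lambda>t. z x t \<omega>)))"

text \<open>\<open>\<pi> P\<^sub>t = \<pi>\<close> for the transition probabilities \<open>P\<^sub>t(x, A) = Pr(z\<^sub>t \<in> A | z\<^sub>0 = x)\<close>.\<close>

definition invariant_distribution ::
  "'a measure \<Rightarrow> (real \<Rightarrow> real \<Rightarrow> 'a \<Rightarrow> real) \<Rightarrow> real measure \<Rightarrow> bool" where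
  "invariant_distribution M z \<pi> \<longleftrightarrow>
     prob_space \<pi> \<and> sets \<pi> = sets borel \<and>
     (\<forall>t\<ge>0. \<forall>A\<in>sets borel.
        (\<integral>\<^sup>+ x. emeasure (distr M borel (z x t)) A \<partial>\<pi>) = emeasure \<pi> A)"

definition feasible_pool :: "(real \<times> real \<Rightarrow> real) \<Rightarrow> real \<Rightarrow> (real \<times> real) set" where
  "feasible_pool f L = {(x, y). 0 \<le> x \<and> 0 \<le> y \<and> f (x, y) = L}"

definition optimal_holdings ::
  "(real \<times> real \<Rightarrow> real) \<Rightarrow> real \<Rightarrow> real \<Rightarrow> real \<Rightarrow> real \<Rightarrow> bool" where
  "optimal_holdings f L P x y \<longleftrightarrow>
     (x, y) \<in> feasible_pool f L \<and>
     (\<forall>(x', y') \<in> feasible_pool f L. P * x + y \<le> P * x' + y')"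

text \<open>The infimum is a minimum whenever optimal holdings exist.\<close>

definition pool_value :: "(real \<times> real \<Rightarrow> real) \<Rightarrow> real \<Rightarrow> real \<Rightarrow> real" where
  "pool_value f L P = (INF (x, y) \<in> feasible_pool f L. P * x + y)"

definition gas_plus :: "(real \<Rightarrow> real) \<Rightarrow> (real \<Rightarrow> real) \<Rightarrow> real \<Rightarrow> real \<Rightarrow> real \<Rightarrow> real" where
  "gas_plus xs ys P \<gamma> \<delta> =
     P * (xs (P * exp (- \<gamma> - \<delta>)) - xs (P * exp (- \<gamma>)))
     + exp \<gamma> * (ys (P * exp (- \<gamma> - \<delta>)) - ys (P * exp (- \<gamma>)))"

definition gas_minus :: "(real \<Rightarrow> real) \<Rightarrow> (real \<Rightarrow> real) \<Rightarrow> real \<Rightarrow> real \<Rightarrow> real \<Rightarrow> real" where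
  "gas_minus xs ys P \<gamma> \<delta> =
     exp \<gamma> * P * (xs (P * exp (\<gamma> + \<delta>)) - xs (P * exp \<gamma>))
     + (ys (P * exp (\<gamma> + \<delta>)) - ys (P * exp \<gamma>))"

definition gas_rate ::
  "real measure \<Rightarrow> (real \<Rightarrow> real) \<Rightarrow> (real \<Rightarrow> real) \<Rightarrow> real \<Rightarrow> real \<Rightarrow> real \<Rightarrow> real \<Rightarrow> real" where
  "gas_rate \<pi> xs ys P r \<gamma> \<delta> =
     r * (gas_plus xs ys P \<gamma> \<delta> * measure \<pi> {\<gamma> + \<delta> <..}
        + gas_minus xs ys P \<gamma> \<delta> * measure \<pi> {..< - (\<gamma> + \<delta>)})"

definition gas_K :: "real \<Rightarrow> real \<Rightarrow> real \<Rightarrow> real \<Rightarrow> real" where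
  "gas_K \<sigma> \<gamma> \<delta> r =
     r / (1 + (\<gamma> + \<delta>) * sqrt (2 * r) / \<sigma> + r * ((\<gamma> + \<delta>)\<^sup>2 - \<gamma>\<^sup>2) / \<sigma>\<^sup>2)"

definition gas_G :: "(real \<Rightarrow> real) \<Rightarrow> (real \<Rightarrow> real) \<Rightarrow> real \<Rightarrow> real \<Rightarrow> real \<Rightarrow> real" where
  "gas_G xs ys P \<gamma> \<delta> =
     P * (xs (P * exp (- \<gamma> - \<delta>)) - xs (P * exp (- \<gamma>))) / 2
     + exp \<gamma> * (ys (P * exp (- \<gamma> - \<delta>)) - ys (P * exp (- \<gamma>))) / 2
     + P * exp \<gamma> * (xs (P * exp (\<gamma> + \<delta>)) - xs (P * exp \<gamma>)) / 2
     + (ys (P * exp (\<gamma> + \<delta>)) - ys (P * exp \<gamma>)) / 2"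

end

(* Applied to a bounded C^1 function f with Lipschitz derivative, the transition semigroup of the
   mispricing process has the derivative L f = sigma^2/2 f'' + r (f o R - f) at time 0, at every
   point other than the two thresholds +-(gamma + delta); here R is the reset map. Up to O(t^2)
   only the event of at most one arrival before t matters, and on it the path differs from the
   undisturbed Brownian path only through that one reset. An invariant distribution has no atoms,
   so by dominated convergence it integrates every L f to 0. Taking f quadratic between the
   thresholds, with exponentially decaying C^1 continuations, makes L f constant on each of the three
   intervals, which gives two linear equations for the two tail probabilities.

   The pool enters through the envelope theorem: x* = V', y* = V - P V', so y*' = -P V'', and each
   of the two gas costs vanishes together with its first derivative in delta at delta = 0. *)

theory Submission
  imports Defs
begin

section \<open>Second-order expansions and the pool\<close>

text \<open>Invariance is an integral of P_t(x, A) over x, but each \<open>z x\<close> is a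
  separately given process, so measurability in x is not part of the model and the integral is only
  a lower integral. Invariance itself repairs this: applied to A and to its complement it yields two
  lower integrals with sum 1, which forces measurability for the completion of \<pi>. The limits are
  therefore taken over \<open>completion \<pi>\<close>. The generator is computed directly on sample
  paths. The delicate event is an arrival before t along a Brownian path that has already moved far:
  by independence its probability is a product of a factor of order t and a factor tending to 0,
  hence o(t). The quadratic and its exponential continuations fit together with equal slopes but
  different second derivatives at the thresholds. This is why f' is only Lipschitz and f'' is used
  pointwise; the exceptional points are those at which the reset map jumps as well. An odd test
  function shows that the two tails are equal, an even one gives their size.\<close>

lemma second_order_remainder_le:
  fixes f f' :: "real \<Rightarrow> real"
  assumes deriv: "\<And>y. (f has_real_derivative f' y) (at y)"
    and bound: "\<And>k. \<bar>k\<bar> \<le> \<bar>h\<bar> \<Longrightarrow> \<bar>f' (x + k) - f' x - D * k\<bar> \<le> e * \<bar>h\<bar>"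
  shows "\<bar>f (x + h) - f x - f' x * h - D / 2 * h\<^sup>2\<bar> \<le> e * h\<^sup>2"
proof -
  define \<rho> where "\<rho> k = f (x + k) - f x - f' x * k - D / 2 * k\<^sup>2" for k
  have "(\<rho> has_real_derivative f' (x + k) - f' x - D * k) (at k within {-\<bar>h\<bar>..\<bar>h\<bar>})" for k
    unfolding \<rho>_def
    by (rule derivative_eq_intros DERIV_chain2[OF deriv] refl | simp)+
  \<comment> \<open>Mean value inequality for the remainder as a function of the increment, whose
    derivative is at most e |h| on [-|h|, |h|].\<close>
  then have "norm (\<rho> h - \<rho> 0) \<le> (e * \<bar>h\<bar>) * norm (h - 0)"
    by (rule field_differentiable_bound[rotated]) (use bound in auto)
  then show ?thesis
    by (simp add: \<rho>_def power2_eq_square mult.assoc)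
qed

text \<open>Taylor expansion with Peano remainder, from differentiability of f' at the single point
  x. It thus applies to test functions whose second derivative jumps elsewhere.\<close>

lemma second_order_remainder_small:
  fixes f f' :: "real \<Rightarrow> real"
  assumes deriv: "\<And>y. (f has_real_derivative f' y) (at y)"
    and deriv2: "(f' has_real_derivative D) (at x)" and "0 < e"
  obtains \<eta> where "0 < \<eta>"
    "\<And>h. \<bar>h\<bar> < \<eta> \<Longrightarrow> \<bar>f (x + h) - f x - f' x * h - D / 2 * h\<^sup>2\<bar> \<le> e * h\<^sup>2"
proof -
  obtain \<eta> where \<eta>: "0 < \<eta>"
    "\<And>y. \<bar>y - x\<bar> < \<eta> \<Longrightarrow> \<bar>f' y - f' x - D * (y - x)\<bar> \<le> e * \<bar>y - x\<bar>"
    using deriv2 \<open>0 < e\<close> unfolding has_field_derivative_def has_derivative_at_alt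
    by (auto simp: mult.commute)
  show thesis
  proof (rule that[OF \<eta>(1)])
    fix h :: real assume h: "\<bar>h\<bar> < \<eta>"
    show "\<bar>f (x + h) - f x - f' x * h - D / 2 * h\<^sup>2\<bar> \<le> e * h\<^sup>2"
    proof (rule second_order_remainder_le[OF deriv])
      fix k :: real assume k: "\<bar>k\<bar> \<le> \<bar>h\<bar>"
      have "\<bar>f' (x + k) - f' x - D * k\<bar> \<le> e * \<bar>k\<bar>"
        using \<eta>(2)[of "x + k"] k h by simp
      also have "\<dots> \<le> e * \<bar>h\<bar>"
        using k \<open>0 < e\<close> by (intro mult_left_mono) auto
      finally show "\<bar>f' (x + k) - f' x - D * k\<bar> \<le> e * \<bar>h\<bar>" .
    qed
  qed
qed

lemma second_order_remainder_smallo: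
  fixes f f' :: "real \<Rightarrow> real"
  assumes "\<And>y. (f has_real_derivative f' y) (at y)" "(f' has_real_derivative D) (at 0)"
    and "f 0 = 0" "f' 0 = 0"
  shows "(\<lambda>h. f h - D / 2 * h\<^sup>2) \<in> o[at_right 0](\<lambda>h. h\<^sup>2)"
proof (rule landau_o.smallI)
  fix e :: real assume "0 < e"
  obtain \<eta> where "0 < \<eta>"
    "\<And>h. \<bar>h\<bar> < \<eta> \<Longrightarrow> \<bar>f (0 + h) - f 0 - f' 0 * h - D / 2 * h\<^sup>2\<bar> \<le> e * h\<^sup>2"
    by (rule second_order_remainder_small[OF assms(1,2) \<open>0 < e\<close>]) blast
  then show "\<forall>\<^sub>F h in at_right 0. norm (f h - D / 2 * h\<^sup>2) \<le> e * norm (h\<^sup>2)"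
    using assms(3,4) unfolding eventually_at_right_field by (intro exI[of _ \<eta>]) auto
qed

section \<open>Pool value and optimal holdings\<close>

lemma pool_value_eq:
  assumes "optimal_holdings f L p x y"
  shows "pool_value f L p = p * x + y"
  unfolding pool_value_def
proof (rule cInf_eq_minimum)
  show "p * x + y \<in> (\<lambda>(x, y). p * x + y) ` feasible_pool f L"
    using assms by (auto simp: optimal_holdings_def image_iff intro!: bexI[of _ "(x, y)"])
qed (use assms in \<open>auto simp: optimal_holdings_def\<close>)

text \<open>The envelope theorem: the line \<open>p \<mapsto> p x + y\<close> through the optimal holdings at \<open>q\<close>
  lies above the value function and touches it at \<open>q\<close>.\<close>

lemma deriv_pool_value_eq_holdings:
  assumes opt: "\<And>p. 0 \<le> p \<Longrightarrow> optimal_holdings f L p (xs p) (ys p)" and "0 < q"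
    and deriv: "(pool_value f L has_real_derivative D) (at q)"
  shows "D = xs q"
proof -
  define gap where "gap p = p * xs q + ys q - pool_value f L p" for p
  have "(gap has_real_derivative xs q - D) (at q)"
    unfolding gap_def by (rule derivative_eq_intros deriv refl | simp)+
  \<comment> \<open>The radius q keeps p nonnegative, where optimal holdings are available.\<close>
  moreover have "gap q \<le> gap p" if "\<bar>q - p\<bar> < q" for p
  proof -
    have "0 \<le> p" using that by linarith
    have "(xs q, ys q) \<in> feasible_pool f L"
      using opt[of q] \<open>0 < q\<close> by (auto simp: optimal_holdings_def)
    then have "p * xs p + ys p \<le> p * xs q + ys q"
      using opt[OF \<open>0 \<le> p\<close>] by (auto simp: optimal_holdings_def)
    then show ?thesis
      using pool_value_eq[OF opt[OF \<open>0 \<le> p\<close>]] pool_value_eq[OF opt[of q]] \<open>0 < q\<close>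
      by (simp add: gap_def)
  qed
  ultimately have "xs q - D = 0"
    using \<open>0 < q\<close> by (intro DERIV_local_min[where d = q]) auto
  then show ?thesis by simp
qed

text \<open>Here v is V''. Its continuity is recorded because the second derivative of the gas costs
  at zero extra fee is obtained from it, without a third derivative of V.\<close>

lemma holdings_have_derivatives:
  assumes opt: "\<And>p. 0 \<le> p \<Longrightarrow> optimal_holdings f L p (xs p) (ys p)"
    and V: "pool_value f L C1_differentiable_on {0<..}"
    and V': "deriv (pool_value f L) C1_differentiable_on {0<..}"
  obtains v where "continuous_on {0<..} v"
    "\<And>q. 0 < q \<Longrightarrow> (xs has_real_derivative v q) (at q)"
    "\<And>q. 0 < q \<Longrightarrow> (ys has_real_derivative - q * v q) (at q)"
proof -
  let ?V = "pool_value f L"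
  obtain D where "\<And>q. 0 < q \<Longrightarrow> (?V has_real_derivative D q) (at q)"
    using V by (auto simp: C1_differentiable_on_def has_real_derivative_iff_has_vector_derivative)
  then have dV: "(?V has_real_derivative xs q) (at q)" if "0 < q" for q
    using deriv_pool_value_eq_holdings[OF opt] that by metis
  obtain v where v: "continuous_on {0<..} v"
    "\<And>q. 0 < q \<Longrightarrow> (deriv ?V has_real_derivative v q) (at q)"
    using V' by (auto simp: C1_differentiable_on_def has_real_derivative_iff_has_vector_derivative)
  have dxs: "(xs has_real_derivative v q) (at q)" if "0 < q" for q
    by (rule has_field_derivative_transform_within_open[OF v(2)[OF that], of "{0<..}"])
      (use that dV DERIV_imp_deriv in auto)
  have dys: "(ys has_real_derivative - q * v q) (at q)" if "0 < q" for q
  proof (rule has_field_derivative_transform_within_open[of "\<lambda>p. ?V p - p * xs p" _ _ "{0<..}"])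
    show "((\<lambda>p. ?V p - p * xs p) has_real_derivative - q * v q) (at q)"
      by (rule derivative_eq_intros dV[OF that] dxs[OF that] refl | simp)+
    show "?V p - p * xs p = ys p" if "p \<in> {0<..}" for p
      using pool_value_eq[OF opt, of p] that by simp
  qed (use that in auto)
  show thesis by (rule that[OF v(1) dxs dys])
qed

section \<open>Gas costs to second order in the extra fee\<close>

lemma tendsto_exp_minus_one_quotient: "((\<lambda>d::real. (exp d - 1) / d) \<longlongrightarrow> 1) (at 0)"
  using DERIV_exp[of 0] by (simp add: DERIV_def)

text \<open>With Q = P exp(\<gamma>) and s = 1, h is the gas cost g_-; with Q = P exp(-\<gamma>) and
  s = -1, it is g_+ divided by exp(\<gamma>). Since y*' = -q x*', the chain rule leaves s q v(q) (Q
  - q) at q = Q exp(s d), and the last factor vanishes at d = 0.\<close>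

lemma gas_fee_derivative:
  assumes v: "continuous_on {0<..} v"
    and xs: "\<And>q. 0 < q \<Longrightarrow> (xs has_real_derivative v q) (at q)"
    and ys: "\<And>q. 0 < q \<Longrightarrow> (ys has_real_derivative - q * v q) (at q)"
    and "0 < Q" and s: "s = 1 \<or> s = -1"
  defines "h \<equiv> \<lambda>d. Q * (xs (Q * exp (s * d)) - xs Q) + (ys (Q * exp (s * d)) - ys Q)"
  shows "(\<lambda>d. h d - (- Q\<^sup>2 * v Q) / 2 * d\<^sup>2) \<in> o[at_right 0](\<lambda>d. d\<^sup>2)"
proof (rule second_order_remainder_smallo)
  let ?q = "\<lambda>d. Q * exp (s * d)"
  let ?h' = "\<lambda>d. s * ?q d * v (?q d) * (Q - ?q d)"
  have q: "0 < ?q d" for d using \<open>0 < Q\<close> by simp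
  show "(h has_real_derivative ?h' d) (at d)" for d
  proof -
    have dq: "(?q has_real_derivative s * ?q d) (at d)"
      by (auto intro!: derivative_eq_intros)
    show ?thesis
      unfolding h_def
      by (rule derivative_eq_intros DERIV_chain2[OF xs[OF q, of d] dq]
          DERIV_chain2[OF ys[OF q, of d] dq] refl | simp add: algebra_simps)+
  qed
  \<comment> \<open>As Q - q = -Q (exp(s d) - 1), the difference quotient of \<open>?h'\<close> at 0
    is a continuous factor times a quotient tending to 1, so v need not be differentiated. The
    second s compensates the one in the denominator.\<close>
  have "((\<lambda>d. - (s * ?q d * v (?q d) * Q * s) * ((exp (s * d) - 1) / (s * d)))
      \<longlongrightarrow> - (s * ?q 0 * v (?q 0) * Q * s) * 1) (at 0)"
  proof (intro tendsto_mult tendsto_minus tendsto_const)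
    have "continuous_on UNIV (\<lambda>d. v (?q d))"
      by (rule continuous_on_compose2[OF v]) (use q in \<open>auto intro!: continuous_intros\<close>)
    then show "((\<lambda>d. v (?q d)) \<longlongrightarrow> v (?q 0)) (at 0)"
      unfolding continuous_on_def by blast
    have "LIM d at 0. s * d :> at 0"
      unfolding filterlim_at using s
      by (auto simp: eventually_at_filter intro!: tendsto_eq_intros)
    from filterlim_compose[OF tendsto_exp_minus_one_quotient this]
    show "((\<lambda>d. (exp (s * d) - 1) / (s * d)) \<longlongrightarrow> 1) (at 0)" .
  qed (auto intro!: tendsto_eq_intros)
  moreover have "- (s * ?q d * v (?q d) * Q * s) * ((exp (s * d) - 1) / (s * d))
      = (?h' (0 + d) - ?h' 0) / d" for d
    using s by (cases "d = 0") (auto simp: field_simps)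
  ultimately show "(?h' has_real_derivative - Q\<^sup>2 * v Q) (at 0)"
    unfolding DERIV_def using s by (auto simp: power2_eq_square mult_ac)
qed (auto simp: h_def)

lemma gas_G_expansion:
  assumes v: "continuous_on {0<..} v"
    and xs: "\<And>q. 0 < q \<Longrightarrow> (xs has_real_derivative v q) (at q)"
    and ys: "\<And>q. 0 < q \<Longrightarrow> (ys has_real_derivative - q * v q) (at q)"
    and "0 < P"
  shows "(\<lambda>d. gas_G xs ys P \<gamma> d
      - P * d\<^sup>2 / 2 * ((deriv ys (P * exp (- \<gamma>)) + exp \<gamma> * deriv ys (P * exp \<gamma>)) / 2))
    \<in> o[at_right 0](\<lambda>d. d\<^sup>2)"
proof -
  define h where "h Q s d = Q * (xs (Q * exp (s * d)) - xs Q) + (ys (Q * exp (s * d)) - ys Q)"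
    for Q s d
  define \<rho> where "\<rho> Q s d = h Q s d - (- Q\<^sup>2 * v Q) / 2 * d\<^sup>2" for Q s d
  let ?Q = "P * exp (- \<gamma>)" and ?R = "P * exp \<gamma>"
  have small: "\<rho> Q s \<in> o[at_right 0](\<lambda>d. d\<^sup>2)" if "0 < Q" "s = 1 \<or> s = -1" for Q s
    using gas_fee_derivative[OF v xs ys that] unfolding \<rho>_def h_def .
  \<comment> \<open>G is this same combination of the two functions h: the weight exp(\<gamma>)
    turns the price P exp(-\<gamma>) in front of x* into P.\<close>
  have "(\<lambda>d. exp \<gamma> / 2 * \<rho> ?Q (-1) d + 1 / 2 * \<rho> ?R 1 d) \<in> o[at_right 0](\<lambda>d. d\<^sup>2)"
    using \<open>0 < P\<close> by (intro sum_in_smallo landau_o.small.cmult_in_iff[THEN iffD2] small) auto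
  also have "(\<lambda>d. exp \<gamma> / 2 * \<rho> ?Q (-1) d + 1 / 2 * \<rho> ?R 1 d) = (\<lambda>d. gas_G xs ys P \<gamma> d
      - P * d\<^sup>2 / 2 * ((deriv ys ?Q + exp \<gamma> * deriv ys ?R) / 2))"
  proof
    fix d
    have dy: "deriv ys ?Q = - ?Q * v ?Q" "deriv ys ?R = - ?R * v ?R"
      using ys[of ?Q] ys[of ?R] \<open>0 < P\<close> by (auto dest!: DERIV_imp_deriv)
    have e: "exp \<gamma> * exp (- \<gamma>) = 1" by (simp flip: exp_add)
    have 1: "exp \<gamma> * h ?Q (-1) d = P * (xs (P * exp (- \<gamma> - d)) - xs ?Q)
        + exp \<gamma> * (ys (P * exp (- \<gamma> - d)) - ys ?Q)"
      using e by (simp add: h_def exp_diff exp_minus field_simps)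
    have 2: "h ?R 1 d = P * exp \<gamma> * (xs (P * exp (\<gamma> + d)) - xs ?R)
        + (ys (P * exp (\<gamma> + d)) - ys ?R)"
      by (simp add: h_def exp_add mult_ac)
    have "exp \<gamma> * ?Q\<^sup>2 = P * ?Q" "?R\<^sup>2 = P * exp \<gamma> * ?R"
      using e by (simp_all add: power2_eq_square field_simps exp_minus)
    then have 3: "exp \<gamma> * (- ?Q\<^sup>2 * v ?Q) = P * deriv ys ?Q"
       "- ?R\<^sup>2 * v ?R = P * (exp \<gamma> * deriv ys ?R)"
      unfolding dy by (metis (no_types, lifting) mult.left_commute mult_minus_left mult_minus_right mult.assoc)+
    have "exp \<gamma> / 2 * \<rho> ?Q (-1) d + 1 / 2 * \<rho> ?R 1 d
      = (exp \<gamma> * h ?Q (-1) d) / 2 + h ?R 1 d / 2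
        - (exp \<gamma> * (- ?Q\<^sup>2 * v ?Q)) * d\<^sup>2 / 4 - (- ?R\<^sup>2 * v ?R) * d\<^sup>2 / 4"
      unfolding \<rho>_def by (simp add: algebra_simps)
    then show "exp \<gamma> / 2 * \<rho> ?Q (-1) d + 1 / 2 * \<rho> ?R 1 d = gas_G xs ys P \<gamma> d
      - P * d\<^sup>2 / 2 * ((deriv ys ?Q + exp \<gamma> * deriv ys ?R) / 2)"
      unfolding 1 2 3 gas_G_def by (simp add: field_simps)
  qed
  finally show ?thesis .
qed

text \<open>Cancelling r leaves the denominator 1/r + A / sqrt r + D, whose limit D is positive
  because \<gamma> and \<delta> are.\<close>

lemma gas_K_tendsto:
  assumes "0 < \<sigma>" "0 < \<gamma>" "0 < \<delta>"
  shows "(gas_K \<sigma> \<gamma> \<delta> \<longlongrightarrow> \<sigma>\<^sup>2 / ((\<gamma> + \<delta>)\<^sup>2 - \<gamma>\<^sup>2)) at_top"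
proof -
  define A where "A = (\<gamma> + \<delta>) * sqrt 2 / \<sigma>"
  define D where "D = ((\<gamma> + \<delta>)\<^sup>2 - \<gamma>\<^sup>2) / \<sigma>\<^sup>2"
  have "0 < D"
    using assms by (auto simp: D_def power2_eq_square algebra_simps intro!: divide_pos_pos add_pos_pos)
  have "((\<lambda>r::real. inverse r + A * inverse (sqrt r) + D) \<longlongrightarrow> 0 + A * 0 + D) at_top"
    by (intro tendsto_intros tendsto_inverse_0_at_top filterlim_ident sqrt_at_top)
  from tendsto_inverse[OF this] \<open>0 < D\<close>
  have "((\<lambda>r::real. inverse (inverse r + A * inverse (sqrt r) + D)) \<longlongrightarrow> inverse D) at_top"
    by simp
  moreover have "\<forall>\<^sub>F r in at_top. inverse (inverse r + A * inverse (sqrt r) + D) = gas_K \<sigma> \<gamma> \<delta> r"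
    using eventually_gt_at_top[of 0]
  proof eventually_elim
    case (elim r)
    have "1 + A * sqrt r + r * D = r * (inverse r + A * inverse (sqrt r) + D)"
      using elim by (simp add: field_simps)
    moreover have "gas_K \<sigma> \<gamma> \<delta> r = r / (1 + A * sqrt r + r * D)"
      by (simp add: gas_K_def A_def D_def real_sqrt_mult)
    ultimately show ?case
      using elim by (simp add: divide_inverse)
  qed
  ultimately have "(gas_K \<sigma> \<gamma> \<delta> \<longlongrightarrow> inverse D) at_top"
    by (rule Lim_transform_eventually)
  then show ?thesis by (simp add: D_def)
qed

section \<open>Invariance of a kernel without measurability assumptions\<close>

text \<open>For an arbitrary p, \<open>nn_integral\<close> is the supremum over simple functions
  below p. Countably many of them suffice to reach it, and their pointwise supremum is a measurable
  minorant with the same integral.\<close>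

lemma nn_integral_eq_measurable_below:
  obtains u where "u \<in> borel_measurable M" "\<And>x. u x \<le> p x" "integral\<^sup>N M u = integral\<^sup>N M p"
proof -
  let ?S = "{g. simple_function M g \<and> g \<le> p}"
  have "(\<lambda>_. 0) \<in> ?S" by (auto simp: le_fun_def)
  then obtain I :: "nat \<Rightarrow> ennreal"
    where I: "range I \<subseteq> integral\<^sup>S M ` ?S" "(SUP g\<in>?S. integral\<^sup>S M g) = (SUP i. I i)"
    using ennreal_SUP_countable_SUP[of ?S "integral\<^sup>S M"] by auto
  have "\<forall>i. \<exists>g. g \<in> ?S \<and> I i = integral\<^sup>S M g" using I(1) by blast
  then obtain G where G: "\<And>i. G i \<in> ?S" "\<And>i. I i = integral\<^sup>S M (G i)" by metis
  define u where "u x = (SUP i. G i x)" for x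
  have "u \<in> borel_measurable M"
    unfolding u_def using G(1)
    by (intro borel_measurable_SUP) (auto intro: borel_measurable_simple_function)
  moreover have "u x \<le> p x" for x
    unfolding u_def using G(1) by (auto intro!: SUP_least simp: le_fun_def)
  moreover have "I i \<le> integral\<^sup>N M u" for i
  proof -
    have "I i = integral\<^sup>N M (G i)"
      using G by (simp add: nn_integral_eq_simple_integral)
    also have "\<dots> \<le> integral\<^sup>N M u"
      by (rule nn_integral_mono) (auto simp: u_def intro: SUP_upper)
    finally show ?thesis .
  qed
  then have "integral\<^sup>N M p \<le> integral\<^sup>N M u"
    using I(2) by (auto simp: nn_integral_def[of M p] intro: SUP_least)
  moreover have "integral\<^sup>N M u \<le> integral\<^sup>N M p"
    by (rule nn_integral_mono) (rule \<open>\<And>x. u x \<le> p x\<close>)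
  ultimately show thesis
    by (intro that[of u] antisym)
qed

text \<open>For a nonmeasurable integrand \<open>\<integral>\<^sup>+\<close> is a lower integral, and the two lower integrals can
  only add up to 1 if \<open>p\<close> lies a.e.\ between functions that agree a.e.\<close>

lemma (in prob_space) complementary_integrands_measurable:
  fixes p q :: "'a \<Rightarrow> ennreal"
  assumes pq: "\<And>x. p x + q x = 1" and int: "integral\<^sup>N M p + integral\<^sup>N M q = 1"
  shows "p \<in> borel_measurable (completion M)"
proof -
  obtain u where u: "u \<in> borel_measurable M" "\<And>x. u x \<le> p x" "integral\<^sup>N M u = integral\<^sup>N M p"
    using nn_integral_eq_measurable_below by blast
  obtain v where v: "v \<in> borel_measurable M" "\<And>x. v x \<le> q x" "integral\<^sup>N M v = integral\<^sup>N M q"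
    using nn_integral_eq_measurable_below by blast
  have le1: "u x + v x \<le> 1" for x
    using add_mono[OF u(2) v(2)] pq by metis
  have int1: "(\<integral>\<^sup>+x. u x + v x \<partial>M) = 1"
    using u v int by (simp add: nn_integral_add)
  have "(\<integral>\<^sup>+x. 1 - (u x + v x) \<partial>M) = (\<integral>\<^sup>+x. 1 \<partial>M) - (\<integral>\<^sup>+x. u x + v x \<partial>M)"
    using u(1) v(1) le1 int1 by (intro nn_integral_diff) auto
  then have "(\<integral>\<^sup>+x. 1 - (u x + v x) \<partial>M) = 0"
    by (simp add: int1 emeasure_space_1)
  then have "AE x in M. 1 - (u x + v x) = 0"
    using u(1) v(1) by (subst (asm) nn_integral_0_iff_AE) auto
  \<comment> \<open>Where u + v reaches 1 = p + q, the bound v \<le> q gives p + q \<le> u + q, and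
    the finite q cancels.\<close>
  then have eq: "AE x in M. u x = p x"
  proof eventually_elim
    case (elim x)
    then have "1 \<le> u x + v x"
      using diff_eq_0_iff_ennreal by auto
    then have sum: "p x + q x \<le> u x + v x" using pq by metis
    have "q x \<le> 1" using pq[of x] by (metis le_iff_add add.commute)
    then have "q x \<noteq> \<top>" by (auto simp: top_unique)
    have "p x + q x \<le> u x + q x"
      using sum add_left_mono[OF v(2)[of x], of "u x"] by (rule order_trans)
    then have "q x + p x \<le> q x + u x"
      by (simp only: add.commute[of "q x"])
    then have "p x \<le> u x"
      using \<open>q x \<noteq> \<top>\<close> by (simp add: ennreal_add_left_cancel_le)
    then show ?case using u(2)[of x] by simp
  qed
  show ?thesis
  proof (rule measurableI)
    fix S :: "ennreal set" assume S: "S \<in> sets borel"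
    show "p -` S \<inter> space (completion M) \<in> sets (completion M)"
    proof (rule completion.in_sets_AE)
      show "u -` S \<inter> space M \<in> sets (completion M)"
        using u(1) S by (auto intro: measurable_sets)
      show "AE x in completion M. (x \<in> u -` S \<inter> space M) = (x \<in> p -` S \<inter> space (completion M))"
        using AE_completion[OF eq] by eventually_elim simp
    qed auto
  qed auto
qed

text \<open>The values on A and on its complement add up to 1 pointwise, and by invariance so do
  their lower integrals. Hence K is a genuine kernel over \<open>completion \<pi>\<close>, and
  invariance on sets becomes the equation \<open>completion \<pi> \<bind> K = \<pi>\<close>, which
  can be integrated against f.\<close>

lemma integral_invariant_kernel:
  fixes K :: "real \<Rightarrow> real measure" and f :: "real \<Rightarrow> real"
  assumes \<pi>: "prob_space \<pi>" "sets \<pi> = sets borel"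
    and K: "\<And>x. prob_space (K x)" "\<And>x. sets (K x) = sets borel"
    and inv: "\<And>A. A \<in> sets borel \<Longrightarrow> (\<integral>\<^sup>+ x. emeasure (K x) A \<partial>\<pi>) = emeasure \<pi> A"
    and f: "f \<in> borel_measurable borel" "\<And>x. \<bar>f x\<bar> \<le> C"
  shows "(\<lambda>x. \<integral>y. f y \<partial>K x) \<in> borel_measurable (completion \<pi>)"
    and "(\<integral>x. (\<integral>y. f y \<partial>K x) \<partial>completion \<pi>) = (\<integral>x. f x \<partial>\<pi>)"
proof -
  interpret \<pi>: prob_space \<pi> by fact
  have sp: "space \<pi> = UNIV" using sets_eq_imp_space_eq[OF \<pi>(2)] by simp
  have Ksp: "space (K x) = UNIV" for x using sets_eq_imp_space_eq[OF K(2)] by simp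
  have meas: "(\<lambda>x. emeasure (K x) A) \<in> borel_measurable (completion \<pi>)" if A: "A \<in> sets borel" for A
  proof (rule \<pi>.complementary_integrands_measurable)
    show "emeasure (K x) A + emeasure (K x) (- A) = 1" for x
    proof -
      interpret prob_space "K x" by (rule K)
      show ?thesis
        using A K(2) emeasure_space_1 plus_emeasure[of A "K x" "- A"] Ksp
        by (simp add: Compl_eq_Diff_UNIV)
    qed
    have "emeasure \<pi> A + emeasure \<pi> (- A) = 1"
      using A \<pi>(2) \<pi>.emeasure_space_1 plus_emeasure[of A \<pi> "- A"] sp
      by (simp add: Compl_eq_Diff_UNIV)
    then show "(\<integral>\<^sup>+x. emeasure (K x) A \<partial>\<pi>) + (\<integral>\<^sup>+x. emeasure (K x) (- A) \<partial>\<pi>) = 1"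
      using A inv by (simp add: borel_comp)
  qed
  have Km: "K \<in> measurable (completion \<pi>) (subprob_algebra borel)"
    using K meas by (intro measurable_subprob_algebra) (auto intro: prob_space_imp_subprob_space)
  have "completion \<pi> \<bind> K = \<pi>"
  proof (rule measure_eqI)
    show "sets (completion \<pi> \<bind> K) = sets \<pi>"
      using \<pi>(2) sp by (subst sets_bind[where N = borel]) (auto simp: K)
    fix A assume "A \<in> sets (completion \<pi> \<bind> K)"
    then have "A \<in> sets borel"
      using sp by (subst (asm) sets_bind[where N = borel]) (auto simp: K)
    then show "emeasure (completion \<pi> \<bind> K) A = emeasure \<pi> A"
      using sp by (subst emeasure_bind[OF _ Km]) (auto simp: nn_integral_completion inv)
  qed
  moreover have "prob_space (completion \<pi>)"
    by (rule prob_spaceI) (simp add: \<pi>.emeasure_space_1)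
  then have "integral\<^sup>L (completion \<pi> \<bind> K) f = (\<integral>x. integral\<^sup>L (K x) f \<partial>completion \<pi>)"
    using f
    by (intro integral_bind[where K = borel and B = C and B' = 1] Km)
      (auto simp: prob_space.finite_measure prob_space.emeasure_space_1[OF K(1)])
  ultimately show "(\<integral>x. (\<integral>y. f y \<partial>K x) \<partial>completion \<pi>) = (\<integral>x. f x \<partial>\<pi>)" by simp
  show "(\<lambda>x. \<integral>y. f y \<partial>K x) \<in> borel_measurable (completion \<pi>)"
    by (rule measurable_compose[OF Km integral_measurable_subprob_algebra[OF f(1)]])
qed

section \<open>Paths up to the second arrival\<close>

definition reset :: "real \<Rightarrow> real \<Rightarrow> real \<Rightarrow> real" where
  "reset \<gamma> \<delta> l = (if l > \<gamma> + \<delta> then \<gamma> else if l < - (\<gamma> + \<delta>) then - \<gamma> else l)"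

text \<open>The path clause provides some left limit at s; continuity of w together with the
  evolution before s identifies it as the undisturbed value to which the reset applies.\<close>

lemma mispricing_path_after_first_arrival:
  assumes path: "mispricing_path \<sigma> \<gamma> \<delta> w T \<zeta>" and cont: "continuous_on {0..} w"
    and "s \<in> T" "0 < s" "s \<le> t" and before: "{0<..<s} \<inter> T = {}" and after: "{s<..t} \<inter> T = {}"
  shows "\<zeta> t = reset \<gamma> \<delta> (\<zeta> 0 + \<sigma> * (w s - w 0)) + \<sigma> * (w t - w s)"
proof -
  have evol: "\<zeta> v - \<zeta> u = \<sigma> * (w v - w u)" if "0 \<le> u" "u \<le> v" "{u<..v} \<inter> T = {}" for u v
    using path that unfolding mispricing_path_def by blast
  obtain l where l: "(\<zeta> \<longlongrightarrow> l) (at_left s)" "\<zeta> s = reset \<gamma> \<delta> l"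
    using path \<open>s \<in> T\<close> unfolding mispricing_path_def reset_def by blast
  have "(w \<longlongrightarrow> w s) (at s within {0..})"
    using cont \<open>0 < s\<close> by (auto simp: continuous_on_def)
  moreover have "at_left s = at s within {0..<s}"
    using \<open>0 < s\<close> by (intro at_within_nhd[of s "{0<..}"]) auto
  ultimately have "(w \<longlongrightarrow> w s) (at_left s)"
    by (auto intro: tendsto_within_subset)
  then have "((\<lambda>u. \<zeta> 0 + \<sigma> * (w u - w 0)) \<longlongrightarrow> \<zeta> 0 + \<sigma> * (w s - w 0)) (at_left s)"
    by (intro tendsto_intros)
  moreover have "\<forall>\<^sub>F u in at_left s. \<zeta> 0 + \<sigma> * (w u - w 0) = \<zeta> u"
  proof -
    have "\<zeta> 0 + \<sigma> * (w u - w 0) = \<zeta> u" if "0 < u" "u < s" for u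
      using evol[of 0 u] before that by fastforce
    then show ?thesis
      unfolding eventually_at_left_field using \<open>0 < s\<close> by blast
  qed
  ultimately have "(\<zeta> \<longlongrightarrow> \<zeta> 0 + \<sigma> * (w s - w 0)) (at_left s)"
    by (rule Lim_transform_eventually)
  then have "l = \<zeta> 0 + \<sigma> * (w s - w 0)"
    using l(1) by (intro tendsto_unique[of "at_left s"]) auto
  then show ?thesis
    using l(2) evol[OF _ \<open>s \<le> t\<close> after] \<open>0 < s\<close> by simp
qed

locale mispricing =
  fixes \<sigma> r \<gamma> \<delta> :: real and M :: "'a measure" and B :: "real \<Rightarrow> 'a \<Rightarrow> real"
    and \<tau> :: "nat \<Rightarrow> 'a \<Rightarrow> real" and z :: "real \<Rightarrow> real \<Rightarrow> 'a \<Rightarrow> real"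
  assumes \<sigma>_pos: "0 < \<sigma>" and r_pos: "0 < r" and \<gamma>_pos: "0 < \<gamma>" and \<delta>_pos: "0 < \<delta>"
    and process: "mispricing_process \<sigma> r \<gamma> \<delta> M B \<tau> z"
begin

section \<open>Laws of the Brownian motion and of the arrival times\<close>

sublocale prob_space M
  using process by (simp add: mispricing_process_def brownian_motion_def)

text \<open>\<open>B 0\<close> vanishes only almost surely; after the subtraction every path starts
  at 0.\<close>

definition W :: "real \<Rightarrow> 'a \<Rightarrow> real" where
  "W t \<omega> = B t \<omega> - B 0 \<omega>"

definition gap :: "nat \<Rightarrow> 'a \<Rightarrow> real" where
  "gap n \<omega> = (case n of 0 \<Rightarrow> \<tau> 0 \<omega> | Suc k \<Rightarrow> \<tau> (Suc k) \<omega> - \<tau> k \<omega>)"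

abbreviation R :: "real \<Rightarrow> real" where
  "R \<equiv> reset \<gamma> \<delta>"

lemma measurable_B: "0 \<le> t \<Longrightarrow> B t \<in> borel_measurable M"
  using process by (simp add: mispricing_process_def brownian_motion_def)

lemma measurable_W [measurable]: "0 \<le> t \<Longrightarrow> W t \<in> borel_measurable M"
  unfolding W_def by (intro borel_measurable_diff measurable_B) auto

lemma measurable_z: "0 \<le> t \<Longrightarrow> z x t \<in> borel_measurable M"
  using process by (simp add: mispricing_process_def)

lemma continuous_B: "AE \<omega> in M. continuous_on {0..} (\<lambda>t. B t \<omega>)"
  using process by (simp add: mispricing_process_def brownian_motion_def)

lemma distributed_W:
  assumes "0 < t"
  shows "distributed M lborel (W t) (normal_density 0 (sqrt t))"
proof -
  have "distributed M lborel (\<lambda>\<omega>. B t \<omega> - B 0 \<omega>) (normal_density 0 (sqrt (t - 0)))"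
    using process assms unfolding mispricing_process_def brownian_motion_def by blast
  then show ?thesis by (simp add: W_def[abs_def])
qed

lemma gap_simps: "gap 0 = \<tau> 0" "gap (Suc n) = (\<lambda>\<omega>. \<tau> (Suc n) \<omega> - \<tau> n \<omega>)"
  by (auto simp: gap_def)

lemma gap_eq: "gap = (\<lambda>n \<omega>. case n of 0 \<Rightarrow> \<tau> 0 \<omega> | Suc k \<Rightarrow> \<tau> (Suc k) \<omega> - \<tau> k \<omega>)"
  by (auto simp: gap_def fun_eq_iff)

lemma arrivals: "poisson_arrivals M r \<tau>"
  using process by (simp add: mispricing_process_def)

lemma distributed_gap: "distributed M lborel (gap n) (exponential_density r)"
  and indep_gap: "indep_vars (\<lambda>_. borel) gap UNIV"
  using arrivals unfolding poisson_arrivals_def Let_def gap_eq by blast+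

lemma measurable_gap: "gap n \<in> borel_measurable M"
  using distributed_measurable[OF distributed_gap] by simp

lemma measurable_\<tau> [measurable]: "\<tau> n \<in> borel_measurable M"
proof (induction n)
  case 0
  then show ?case using measurable_gap[of 0] by (simp add: gap_simps)
next
  case (Suc n)
  have "\<tau> (Suc n) = (\<lambda>\<omega>. gap (Suc n) \<omega> + \<tau> n \<omega>)" by (simp add: gap_simps)
  then show ?case using measurable_gap[of "Suc n"] Suc by (metis borel_measurable_add)
qed

lemma gap_positive: "AE \<omega> in M. \<forall>n. 0 < gap n \<omega>"
  unfolding AE_all_countable
proof
  fix n
  have "prob {\<omega> \<in> space M. 0 < gap n \<omega>} = 1"
    using exponential_distributedD_gt[OF distributed_gap _ r_pos, of 0 n] by simp
  from AE_prob_1[OF this] show "AE \<omega> in M. 0 < gap n \<omega>"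
    by auto
qed

lemma arrivals_increasing: "AE \<omega> in M. 0 < \<tau> 0 \<omega> \<and> (\<forall>n. \<tau> 0 \<omega> \<le> \<tau> n \<omega>) \<and> (\<forall>n. \<tau> 1 \<omega> \<le> \<tau> (Suc n) \<omega>)"
  using gap_positive
proof eventually_elim
  case (elim \<omega>)
  have "0 < gap 0 \<omega>" using elim by blast
  moreover have less: "\<tau> n \<omega> < \<tau> (Suc n) \<omega>" for n
    using elim[rule_format, of "Suc n"] by (simp add: gap_simps)
  have mono: "\<tau> m \<omega> \<le> \<tau> n \<omega>" if "m \<le> n" for m n
    by (rule lift_Suc_mono_le[OF _ that]) (use less in \<open>simp add: less_imp_le\<close>)
  ultimately show ?case by (auto simp: gap_simps)
qed

lemma prob_first_arrival: "0 \<le> t \<Longrightarrow> prob {\<omega> \<in> space M. \<tau> 0 \<omega> \<le> t} = 1 - exp (- t * r)"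
  using exponential_distributedD_le[OF distributed_gap[of 0] _ r_pos] by (simp add: gap_simps)

lemma prob_first_arrival_le:
  assumes "0 \<le> t"
  shows "prob {\<omega> \<in> space M. \<tau> 0 \<omega> \<le> t} \<le> r * t"
  using prob_first_arrival[OF assms] exp_ge_add_one_self[of "- t * r"]
  by (simp add: algebra_simps)

text \<open>Two arrivals before t force both of the first two waiting times below t. By independence
  this has probability of order t^2, negligible after division by t.\<close>

lemma prob_second_arrival_le:
  assumes "0 \<le> t"
  shows "prob {\<omega> \<in> space M. \<tau> 1 \<omega> \<le> t} \<le> (r * t)\<^sup>2"
proof -
  let ?E = "\<lambda>n. gap n -` {..t} \<inter> space M"
  have gap_le: "prob (?E n) \<le> r * t" for n
  proof -
    have "?E n = {\<omega> \<in> space M. gap n \<omega> \<le> t}" by auto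
    then show ?thesis
      using exponential_distributedD_le[OF distributed_gap[of n] assms r_pos]
        exp_ge_add_one_self[of "- t * r"] by (simp add: algebra_simps)
  qed
  have "prob {\<omega> \<in> space M. \<tau> 1 \<omega> \<le> t} \<le> prob (\<Inter>n\<in>{0, 1}. ?E n)"
  proof (rule finite_measure_mono_AE)
    show "AE \<omega> in M. \<omega> \<in> {\<omega> \<in> space M. \<tau> 1 \<omega> \<le> t} \<longrightarrow> \<omega> \<in> (\<Inter>n\<in>{0, 1}. ?E n)"
      using gap_positive
    proof eventually_elim
      case (elim \<omega>)
      have "0 < gap 0 \<omega>" "0 < gap 1 \<omega>" using elim by blast+
      then show ?case by (auto simp: gap_simps(1) gap_simps(2)[of 0, simplified])
    qed
    have "?E n \<in> events" for n using measurable_gap by (rule measurable_sets) auto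
    then show "(\<Inter>n\<in>{0, 1}. ?E n) \<in> events" by simp
  qed
  also have "\<dots> = (\<Prod>n\<in>{0, 1}. prob (?E n))"
    using indep_gap by (rule indep_varsD) auto
  also have "\<dots> = prob (?E 0) * prob (?E 1)" by simp
  also have "\<dots> \<le> (r * t) * (r * t)"
    using assms r_pos by (intro mult_mono gap_le) auto
  finally show ?thesis by (simp add: power2_eq_square)
qed

section \<open>The process up to the second arrival\<close>

lemma z_before_first_arrival:
  assumes "0 \<le> t"
  shows "AE \<omega> in M. t < \<tau> 0 \<omega> \<longrightarrow> z x t \<omega> = x + \<sigma> * W t \<omega>"
proof -
  have "AE \<omega> in M. z x 0 \<omega> = x \<and>
      mispricing_path \<sigma> \<gamma> \<delta> (\<lambda>t. B t \<omega>) (range (\<lambda>n. \<tau> n \<omega>)) (\<lambda>t. z x t \<omega>)"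
    using process by (simp add: mispricing_process_def)
  then show ?thesis
    using arrivals_increasing
  proof eventually_elim
    case (elim \<omega>)
    show ?case
    proof
      assume "t < \<tau> 0 \<omega>"
      then have "{0<..t} \<inter> range (\<lambda>n. \<tau> n \<omega>) = {}"
        using elim(2) by (auto simp: disjoint_iff) (meson less_le_trans not_le)
      then have "z x t \<omega> - z x 0 \<omega> = \<sigma> * (B t \<omega> - B 0 \<omega>)"
        using elim(1) \<open>0 \<le> t\<close> unfolding mispricing_path_def by blast
      then show "z x t \<omega> = x + \<sigma> * W t \<omega>"
        using elim(1) by (simp add: W_def)
    qed
  qed
qed

lemma z_after_first_arrival:
  "AE \<omega> in M. \<tau> 0 \<omega> \<le> t \<and> t < \<tau> 1 \<omega> \<longrightarrow>
    z x t \<omega> = R (x + \<sigma> * W (\<tau> 0 \<omega>) \<omega>) + \<sigma> * (W t \<omega> - W (\<tau> 0 \<omega>) \<omega>)"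
proof -
  have "AE \<omega> in M. z x 0 \<omega> = x \<and>
      mispricing_path \<sigma> \<gamma> \<delta> (\<lambda>t. B t \<omega>) (range (\<lambda>n. \<tau> n \<omega>)) (\<lambda>t. z x t \<omega>)"
    using process by (simp add: mispricing_process_def)
  then show ?thesis
    using arrivals_increasing continuous_B
  proof eventually_elim
    case (elim \<omega>)
    show ?case
    proof
      assume t: "\<tau> 0 \<omega> \<le> t \<and> t < \<tau> 1 \<omega>"
      have "\<tau> n \<omega> = \<tau> 0 \<omega> \<or> t < \<tau> n \<omega>" for n
        using elim(2) t by (cases n) (auto intro: less_le_trans)
      then have "{\<tau> 0 \<omega><..t} \<inter> range (\<lambda>n. \<tau> n \<omega>) = {}"
        by (auto simp: disjoint_iff) (metis less_irrefl not_le)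
      moreover have "{0<..<\<tau> 0 \<omega>} \<inter> range (\<lambda>n. \<tau> n \<omega>) = {}"
        using elim(2) by (auto simp: disjoint_iff) (meson not_le)
      ultimately show "z x t \<omega> = R (x + \<sigma> * W (\<tau> 0 \<omega>) \<omega>) + \<sigma> * (W t \<omega> - W (\<tau> 0 \<omega>) \<omega>)"
        using mispricing_path_after_first_arrival[of \<sigma> \<gamma> \<delta> "\<lambda>t. B t \<omega>"
            "range (\<lambda>n. \<tau> n \<omega>)" "\<lambda>t. z x t \<omega>" "\<tau> 0 \<omega>" t] elim t
        by (simp add: W_def)
    qed
  qed
qed

section \<open>Oscillation of the Brownian path over short times\<close>

definition wild :: "real \<Rightarrow> real \<Rightarrow> 'a set" where
  "wild \<rho> t = {\<omega> \<in> space M. \<exists>s\<in>{0<..<t} \<inter> \<rat>. \<rho> < \<bar>W s \<omega>\<bar>}"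

text \<open>Testing rational times makes the event a countable union of conditions on single times.
  It has to lie in the sigma-algebra generated by B, since independence is stated for that
  sigma-algebra.\<close>

lemma wild_vimage:
  "wild \<rho> t \<in> sets (vimage_algebra (space M) (\<lambda>\<omega>. \<lambda>t\<in>{0..}. B t \<omega>) (PiM {0..} (\<lambda>_. borel)))"
proof -
  let ?P = "PiM {0..} (\<lambda>_. borel) :: (real \<Rightarrow> real) measure"
  let ?S = "\<Union>s\<in>{0<..<t} \<inter> \<rat>. {g \<in> space ?P. \<rho> < \<bar>g s - g 0\<bar>}"
  have "?S \<in> sets ?P"
  proof (rule sets.countable_UN'')
    show "countable ({0<..<t} \<inter> \<rat>)" by (intro countable_Int2 countable_rat)
    fix s :: real assume "s \<in> {0<..<t} \<inter> \<rat>"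
    then have [measurable]: "(\<lambda>g. g s) \<in> borel_measurable ?P" "(\<lambda>g. g 0) \<in> borel_measurable ?P"
      by (auto intro!: measurable_component_singleton)
    show "{g \<in> space ?P. \<rho> < \<bar>g s - g 0\<bar>} \<in> sets ?P" by measurable
  qed
  from in_vimage_algebra[OF this, of "\<lambda>\<omega>. \<lambda>t\<in>{0..}. B t \<omega>" "space M"]
  show ?thesis
    by (rule back_subst[where P = "\<lambda>A. A \<in> _"])
      (auto simp: wild_def W_def space_PiM intro!: bexI[of _ s for s])
qed

lemma indep_BM_arrivals: "indep_set
    (sets (vimage_algebra (space M) (\<lambda>\<omega>. \<lambda>t\<in>{0..}. B t \<omega>) (PiM {0..} (\<lambda>_. borel))))
    (sets (vimage_algebra (space M) (\<lambda>\<omega> n. \<tau> n \<omega>) (PiM UNIV (\<lambda>_. borel))))"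
  using process by (simp add: mispricing_process_def)

lemma wild_event [measurable]: "wild \<rho> t \<in> events"
  using indep_setD_ev1[OF indep_BM_arrivals] wild_vimage by blast

text \<open>This product is how the independence of B and the arrivals enters: one factor is at most
  r t, the other tends to 0.\<close>

lemma prob_wild_and_first_arrival:
  "prob (wild \<rho> t \<inter> {\<omega> \<in> space M. \<tau> 0 \<omega> \<le> t}) = prob (wild \<rho> t) * prob {\<omega> \<in> space M. \<tau> 0 \<omega> \<le> t}"
proof (rule indep_setD[OF indep_BM_arrivals wild_vimage])
  let ?P = "PiM UNIV (\<lambda>_. borel) :: (nat \<Rightarrow> real) measure"
  have "{g \<in> space ?P. g 0 \<le> t} \<in> sets ?P" by measurable
  from in_vimage_algebra[OF this, of "\<lambda>\<omega> n. \<tau> n \<omega>" "space M"]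
  show "{\<omega> \<in> space M. \<tau> 0 \<omega> \<le> t} \<in> sets (vimage_algebra (space M) (\<lambda>\<omega> n. \<tau> n \<omega>) ?P)"
    by (rule back_subst[where P = "\<lambda>A. A \<in> _"]) (auto simp: space_PiM)
qed

text \<open>Rational times in (0, t) are dense in [0, t], so by continuity the bound extends to all
  times there. Being uniform in s, it may be used at the random time
  \<open>\<tau> 0 \<omega>\<close>.\<close>

lemma not_wild:
  assumes "0 < t"
  shows "AE \<omega> in M. \<omega> \<notin> wild \<rho> t \<longrightarrow> (\<forall>s\<in>{0..t}. \<bar>W s \<omega>\<bar> \<le> \<rho>)"
  using continuous_B AE_space
proof eventually_elim
  case (elim \<omega>)
  show ?case
  proof (intro impI ballI)
    fix s assume tame: "\<omega> \<notin> wild \<rho> t" and s: "s \<in> {0..t}"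
    have "{0<..<t} \<subseteq> closure ({0<..<t} \<inter> \<rat>)"
      using open_Int_closure_subset[of "{0<..<t}" "\<rat>"] by (simp add: Rats_closure_real)
    then have sub: "{0..t} \<subseteq> closure ({0<..<t} \<inter> \<rat>)"
      using closure_minimal[OF _ closed_closure] closure_greaterThanLessThan[OF assms] by metis
    have "closure ({0<..<t} \<inter> \<rat>) \<subseteq> {0..}"
      by (rule closure_minimal[OF _ closed_atLeast]) auto
    then have "continuous_on (closure ({0<..<t} \<inter> \<rat>)) (\<lambda>s. \<bar>W s \<omega>\<bar>)"
      unfolding W_def by (intro continuous_intros continuous_on_subset[OF elim(1)])
    moreover have "\<bar>W s \<omega>\<bar> \<le> \<rho>" if "s \<in> {0<..<t} \<inter> \<rat>" for s
      using tame that elim(2) by (auto simp: wild_def not_less)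
    moreover have "s \<in> closure ({0<..<t} \<inter> \<rat>)"
      using sub s by blast
    ultimately show "\<bar>W s \<omega>\<bar> \<le> \<rho>"
      using continuous_le_on_closure by blast
  qed
qed

text \<open>Along these times the events decrease, and a path that lies in all of them is
  discontinuous at 0.\<close>

lemma prob_wild_tendsto:
  assumes "0 < \<rho>"
  shows "(\<lambda>n. prob (wild \<rho> (1 / real (Suc n)))) \<longlonglongrightarrow> 0"
proof -
  let ?A = "\<lambda>n. wild \<rho> (1 / real (Suc n))"
  have "decseq ?A"
  proof (rule decseq_SucI)
    fix n
    have "1 / real (Suc (Suc n)) \<le> 1 / real (Suc n)" by (simp add: frac_le)
    then show "?A (Suc n) \<subseteq> ?A n" unfolding wild_def by fastforce
  qed
  then have "(\<lambda>n. prob (?A n)) \<longlonglongrightarrow> prob (\<Inter>n. ?A n)"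
    by (intro finite_Lim_measure_decseq) auto
  moreover have "prob (\<Inter>n. ?A n) = 0"
  proof -
    have "AE \<omega> in M. \<omega> \<notin> (\<Inter>n. ?A n)"
      using continuous_B
    proof eventually_elim
      case (elim \<omega>)
      then have "\<forall>\<^sub>F s in at 0 within {0..}. dist (B s \<omega>) (B 0 \<omega>) < \<rho>"
        using \<open>0 < \<rho>\<close> by (intro tendstoD) (auto simp: continuous_on_def)
      then obtain d where d: "0 < d" "\<And>s. 0 < s \<Longrightarrow> s < d \<Longrightarrow> \<bar>W s \<omega>\<bar> < \<rho>"
        unfolding eventually_at by (auto simp: dist_real_def W_def)
      obtain n where n: "1 / real (Suc n) < d"
        using d(1) nat_approx_posE by metis
      have "\<not> \<rho> < \<bar>W s \<omega>\<bar>" if "0 < s" "s < 1 / real (Suc n)" for s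
        using d(2)[of s] that n by (simp add: not_less)
      then have "\<omega> \<notin> ?A n" by (auto simp: wild_def)
      then show ?case by blast
    qed
    then show ?thesis by (intro prob_eq_0[THEN iffD2]) auto
  qed
  ultimately show ?thesis by simp
qed

end

section \<open>The generator\<close>

lemma abs_integral_le_AE:
  fixes f g :: "'a \<Rightarrow> real"
  assumes "integrable M f" "integrable M g" "AE x in M. \<bar>f x\<bar> \<le> g x"
  shows "\<bar>\<integral>x. f x \<partial>M\<bar> \<le> (\<integral>x. g x \<partial>M)"
proof -
  have "\<bar>\<integral>x. f x \<partial>M\<bar> \<le> (\<integral>x. \<bar>f x\<bar> \<partial>M)" by (rule integral_abs_bound)
  also have "\<dots> \<le> (\<integral>x. g x \<partial>M)" using assms by (intro integral_mono_AE) auto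
  finally show ?thesis .
qed

context mispricing
begin

section \<open>The diffusion part of the generator\<close>

lemma expectation_W:
  assumes "0 < t" and g: "g \<in> borel_measurable borel"
    and int: "has_bochner_integral lborel (\<lambda>y. normal_density 0 (sqrt t) y * g y) c"
  shows "integrable M (\<lambda>\<omega>. g (W t \<omega>))" "expectation (\<lambda>\<omega>. g (W t \<omega>)) = c"
  using distributed_integrable[OF distributed_W[OF \<open>0 < t\<close>], of g]
    distributed_integral[OF distributed_W[OF \<open>0 < t\<close>], of g] g
    has_bochner_integral_integrable[of lborel] int
  by (auto simp: has_bochner_integral_iff)

text \<open>The fourth moment, of order t^2, serves to absorb the Taylor error at large
  increments.\<close>

lemma W_moments:
  assumes "0 < t"
  shows "integrable M (W t)" "expectation (W t) = 0"
    and "integrable M (\<lambda>\<omega>. (W t \<omega>)\<^sup>2)" "expectation (\<lambda>\<omega>. (W t \<omega>)\<^sup>2) = t"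
    and "integrable M (\<lambda>\<omega>. W t \<omega> ^ 4)" "expectation (\<lambda>\<omega>. W t \<omega> ^ 4) = 3 * t\<^sup>2"
proof -
  have s: "0 < sqrt t" using assms by simp
  show "integrable M (W t)" "expectation (W t) = 0"
    using expectation_W[OF assms, of "\<lambda>y. y" 0] normal_moment_odd[OF s, of 0 0] by simp_all
  show "integrable M (\<lambda>\<omega>. (W t \<omega>)\<^sup>2)" "expectation (\<lambda>\<omega>. (W t \<omega>)\<^sup>2) = t"
    using expectation_W[OF assms, of "\<lambda>y. y\<^sup>2" t] normal_moment_even[OF s, of 0 1] assms
    by (simp_all add: fact_numeral)
  \<comment> \<open>The closed form (2k)! / ((2 / s^2)^k k!) of the even normal moments, for k = 2
    and variance s^2 = t.\<close>
  have "fact 4 / ((2 / t)\<^sup>2 * 2) = 3 * t\<^sup>2"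
    using assms by (simp add: fact_numeral power_divide)
  then show "integrable M (\<lambda>\<omega>. W t \<omega> ^ 4)" "expectation (\<lambda>\<omega>. W t \<omega> ^ 4) = 3 * t\<^sup>2"
    using expectation_W[OF assms, of "\<lambda>y. y ^ 4" "3 * t\<^sup>2"] normal_moment_even[OF s, of 0 2] assms
    by simp_all
qed

text \<open>Closer to x than either threshold, R is the identity or constant. At a threshold itself
  it jumps by \<delta>.\<close>

lemma reset_near:
  assumes "x \<noteq> \<gamma> + \<delta>" "x \<noteq> - (\<gamma> + \<delta>)"
  obtains d where "0 < d" "\<And>y. \<bar>y - x\<bar> < d \<Longrightarrow> \<bar>R y - R x\<bar> \<le> \<bar>y - x\<bar>"
proof
  show "0 < min \<bar>x - (\<gamma> + \<delta>)\<bar> \<bar>x + (\<gamma> + \<delta>)\<bar>" using assms by auto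
  show "\<bar>R y - R x\<bar> \<le> \<bar>y - x\<bar>" if "\<bar>y - x\<bar> < min \<bar>x - (\<gamma> + \<delta>)\<bar> \<bar>x + (\<gamma> + \<delta>)\<bar>" for y
    using that \<gamma>_pos \<delta>_pos unfolding reset_def by (auto split: if_splits)
qed

context
  fixes f f' :: "real \<Rightarrow> real" and C K :: real
  assumes f_bound: "\<And>y. \<bar>f y\<bar> \<le> C" and f_deriv: "\<And>y. (f has_real_derivative f' y) (at y)"
    and f'_lip: "\<And>y y'. \<bar>f' y - f' y'\<bar> \<le> K * \<bar>y - y'\<bar>"
begin

lemma f_isCont: "isCont f y"
  using DERIV_isCont[OF f_deriv] .

lemma f_measurable [measurable]: "f \<in> borel_measurable borel"
  by (intro borel_measurable_continuous_onI continuous_at_imp_continuous_on) (auto simp: f_isCont)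

lemma K_nonneg: "0 \<le> K"
  using f'_lip[of 1 0] abs_ge_zero[of "f' 1 - f' 0"] by simp

lemma C_nonneg: "0 \<le> C"
  using f_bound[of 0] by simp

lemma integrable_f: "X \<in> borel_measurable M \<Longrightarrow> integrable M (\<lambda>\<omega>. f (X \<omega>))"
  by (rule integrable_const_bound[where B = C]) (auto simp: f_bound)

lemma first_order_remainder: "\<bar>f (x + h) - f x - f' x * h\<bar> \<le> K * h\<^sup>2"
proof -
  \<comment> \<open>The second-order estimate with D = 0: the Lipschitz bound on f' takes the place
    of a second derivative.\<close>
  have "\<bar>f' (x + k) - f' x - 0 * k\<bar> \<le> K * \<bar>h\<bar>" if "\<bar>k\<bar> \<le> \<bar>h\<bar>" for k
    using f'_lip[of "x + k" x] mult_left_mono[OF that K_nonneg] by simp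
  from second_order_remainder_le[OF f_deriv this] show ?thesis by simp
qed

text \<open>The linear Taylor term has mean 0, and the others are integrated through the moments t
  and 3 t^2. The choice a = 0, e = K, c = 0 gives a bound uniform in x, the choice a = D/2 the
  limit.\<close>

lemma diffusion_estimate:
  assumes "0 < t" and bound: "\<And>h. \<bar>f (x + h) - f x - f' x * h - a * h\<^sup>2\<bar> \<le> e * h\<^sup>2 + c * h ^ 4"
  shows "\<bar>expectation (\<lambda>\<omega>. f (x + \<sigma> * W t \<omega>)) - f x - a * \<sigma>\<^sup>2 * t\<bar>
    \<le> e * \<sigma>\<^sup>2 * t + 3 * c * \<sigma> ^ 4 * t\<^sup>2"
proof -
  let ?g = "\<lambda>\<omega>. f (x + \<sigma> * W t \<omega>) - f x - (f' x * \<sigma>) * W t \<omega> - (a * \<sigma>\<^sup>2) * (W t \<omega>)\<^sup>2"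
  let ?b = "\<lambda>\<omega>. (e * \<sigma>\<^sup>2) * (W t \<omega>)\<^sup>2 + (c * \<sigma> ^ 4) * W t \<omega> ^ 4"
  note m = W_moments[OF \<open>0 < t\<close>]
  have f: "integrable M (\<lambda>\<omega>. f (x + \<sigma> * W t \<omega>))"
    using \<open>0 < t\<close> by (intro integrable_f) simp
  have "\<bar>expectation ?g\<bar> \<le> expectation ?b"
  proof (rule abs_integral_le_AE)
    have "\<bar>?g \<omega>\<bar> \<le> ?b \<omega>" for \<omega>
      using bound[of "\<sigma> * W t \<omega>"] by (simp add: power_mult_distrib mult.assoc)
    then show "AE \<omega> in M. \<bar>?g \<omega>\<bar> \<le> ?b \<omega>" by simp
  qed (use f m in auto)
  also have "expectation ?b = e * \<sigma>\<^sup>2 * t + 3 * c * \<sigma> ^ 4 * t\<^sup>2"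
    using m by simp
  also have "expectation ?g = expectation (\<lambda>\<omega>. f (x + \<sigma> * W t \<omega>)) - f x - a * \<sigma>\<^sup>2 * t"
    using f m by (simp add: prob_space)
  finally show ?thesis .
qed

lemma diffusion_bound:
  assumes "0 < t"
  shows "\<bar>expectation (\<lambda>\<omega>. f (x + \<sigma> * W t \<omega>)) - f x\<bar> \<le> K * \<sigma>\<^sup>2 * t"
  using diffusion_estimate[OF assms, of x 0 K 0] first_order_remainder by simp

lemma diffusion_limit:
  assumes deriv2: "(f' has_real_derivative D) (at x)"
  shows "((\<lambda>t. (expectation (\<lambda>\<omega>. f (x + \<sigma> * W t \<omega>)) - f x) / t) \<longlongrightarrow> \<sigma>\<^sup>2 / 2 * D) (at_right 0)"
proof (rule tendstoI)
  fix e :: real assume "0 < e"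
  \<comment> \<open>The quadratic error contributes e' \<sigma>^2 t, which is half of e t.\<close>
  define e' where "e' = e / (2 * \<sigma>\<^sup>2)"
  have e': "0 < e'" "e' * \<sigma>\<^sup>2 < e"
    using \<open>0 < e\<close> \<sigma>_pos by (simp_all add: e'_def)
  obtain \<eta> where \<eta>: "0 < \<eta>"
    "\<And>h. \<bar>h\<bar> < \<eta> \<Longrightarrow> \<bar>f (x + h) - f x - f' x * h - D / 2 * h\<^sup>2\<bar> \<le> e' * h\<^sup>2"
    using second_order_remainder_small[OF f_deriv deriv2 e'(1)] by blast
  \<comment> \<open>For |h| at least \<eta> one has h^2 \<le> h^4 / \<eta>^2, so the crude quadratic
    bound is at most c h^4, whose mean is o(t).\<close>
  define c where "c = (K + \<bar>D / 2\<bar>) / \<eta>\<^sup>2"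
  have "0 \<le> c" using K_nonneg by (simp add: c_def)
  have bound: "\<bar>f (x + h) - f x - f' x * h - D / 2 * h\<^sup>2\<bar> \<le> e' * h\<^sup>2 + c * h ^ 4" for h
  proof (cases "\<bar>h\<bar> < \<eta>")
    case True
    have "0 \<le> c * h ^ 4" using \<open>0 \<le> c\<close> by simp
    then show ?thesis using \<eta>(2)[OF True] by linarith
  next
    case False
    have "\<bar>f (x + h) - f x - f' x * h - D / 2 * h\<^sup>2\<bar> \<le> K * h\<^sup>2 + \<bar>D / 2 * h\<^sup>2\<bar>"
      using first_order_remainder[of x h] by linarith
    also have "\<dots> = c * (\<eta>\<^sup>2 * h\<^sup>2)"
      using \<eta>(1) by (simp add: c_def abs_mult field_simps)
    also have "\<dots> \<le> c * (h\<^sup>2 * h\<^sup>2)"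
    proof (intro mult_left_mono mult_right_mono \<open>0 \<le> c\<close>)
      show "\<eta>\<^sup>2 \<le> h\<^sup>2" using False \<eta>(1) by (simp add: abs_le_square_iff[symmetric])
    qed simp
    also have "\<dots> \<le> e' * h\<^sup>2 + c * h ^ 4"
      using e'(1) by (simp flip: power_add)
    finally show ?thesis .
  qed
  have "((\<lambda>t. e' * \<sigma>\<^sup>2 + 3 * c * \<sigma> ^ 4 * t) \<longlongrightarrow> e' * \<sigma>\<^sup>2 + 3 * c * \<sigma> ^ 4 * 0) (at_right 0)"
    by (intro tendsto_intros)
  then have "\<forall>\<^sub>F t in at_right 0. e' * \<sigma>\<^sup>2 + 3 * c * \<sigma> ^ 4 * t < e"
    using e'(2) by (intro order_tendstoD) auto
  moreover have "\<forall>\<^sub>F t::real in at_right 0. 0 < t" by (simp add: eventually_at_right_less)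
  ultimately show "\<forall>\<^sub>F t in at_right 0.
      dist ((expectation (\<lambda>\<omega>. f (x + \<sigma> * W t \<omega>)) - f x) / t) (\<sigma>\<^sup>2 / 2 * D) < e"
  proof eventually_elim
    case (elim t)
    let ?E = "expectation (\<lambda>\<omega>. f (x + \<sigma> * W t \<omega>)) - f x"
    have "\<bar>?E - D / 2 * \<sigma>\<^sup>2 * t\<bar> \<le> (e' * \<sigma>\<^sup>2 + 3 * c * \<sigma> ^ 4 * t) * t"
      using diffusion_estimate[OF elim(2) bound]
      by (simp add: algebra_simps power2_eq_square)
    also have "\<dots> < e * t" using elim by simp
    finally have "\<bar>?E - D / 2 * \<sigma>\<^sup>2 * t\<bar> / t < e" using elim(2) by (simp add: field_simps)
    moreover have "\<bar>?E - D / 2 * \<sigma>\<^sup>2 * t\<bar> / t = \<bar>?E / t - \<sigma>\<^sup>2 / 2 * D\<bar>"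
      using elim(2) by (simp add: field_simps flip: abs_div_pos)
    ultimately show ?case by (simp add: dist_real_def)
  qed
qed

section \<open>The jump part of the generator\<close>

lemma jump_bound:
  assumes "0 \<le> t"
  shows "\<bar>expectation (\<lambda>\<omega>. f (z x t \<omega>)) - expectation (\<lambda>\<omega>. f (x + \<sigma> * W t \<omega>))\<bar> \<le> 2 * C * (r * t)"
proof -
  let ?A = "{\<omega> \<in> space M. \<tau> 0 \<omega> \<le> t}"
  have fz: "integrable M (\<lambda>\<omega>. f (z x t \<omega>))" and fW: "integrable M (\<lambda>\<omega>. f (x + \<sigma> * W t \<omega>))"
    using assms by (auto intro!: integrable_f measurable_z)
  have A: "integrable M (\<lambda>\<omega>. 2 * C * indicat_real ?A \<omega>)"
    by (intro integrable_mult_right integrable_real_indicator) (auto simp: less_top[symmetric])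
  have "AE \<omega> in M. \<bar>f (z x t \<omega>) - f (x + \<sigma> * W t \<omega>)\<bar> \<le> 2 * C * indicat_real ?A \<omega>"
    using z_before_first_arrival[OF assms, of x] AE_space
  proof eventually_elim
    case (elim \<omega>)
    have "\<bar>f (z x t \<omega>) - f (x + \<sigma> * W t \<omega>)\<bar> \<le> 2 * C"
      using f_bound[of "z x t \<omega>"] f_bound[of "x + \<sigma> * W t \<omega>"] by linarith
    then show ?case
      using elim by (cases "\<tau> 0 \<omega> \<le> t") auto
  qed
  then have "\<bar>expectation (\<lambda>\<omega>. f (z x t \<omega>) - f (x + \<sigma> * W t \<omega>))\<bar>
      \<le> expectation (\<lambda>\<omega>. 2 * C * indicat_real ?A \<omega>)"
    using fz fW A by (intro abs_integral_le_AE) auto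
  also have "\<dots> = 2 * C * prob ?A" by simp
  also have "\<dots> \<le> 2 * C * (r * t)"
    using C_nonneg prob_first_arrival_le[OF assms] by (intro mult_left_mono) auto
  finally show ?thesis
    using fz fW by simp
qed

text \<open>Before the first arrival the two paths coincide. After exactly one arrival on a tame
  path, f at \<open>z x t\<close> is e/2-close to \<open>f (R x)\<close> and f at the undisturbed
  point e/2-close to \<open>f x\<close>. On wild paths or after two arrivals the crude bound 4 C is
  enough. The three terms of \<open>?b\<close> reflect the last three possibilities.\<close>

lemma jump_estimate:
  assumes "0 < t" "0 \<le> e"
    and reset_close: "\<And>y h. \<bar>y - x\<bar> \<le> \<sigma> * \<rho> \<Longrightarrow> \<bar>h\<bar> \<le> 2 * (\<sigma> * \<rho>) \<Longrightarrow> \<bar>f (R y + h) - f (R x)\<bar> \<le> e / 2"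
    and close: "\<And>y. \<bar>y - x\<bar> \<le> \<sigma> * \<rho> \<Longrightarrow> \<bar>f y - f x\<bar> \<le> e / 2"
  defines "p \<equiv> prob {\<omega> \<in> space M. \<tau> 0 \<omega> \<le> t}"
  shows "\<bar>expectation (\<lambda>\<omega>. f (z x t \<omega>)) - expectation (\<lambda>\<omega>. f (x + \<sigma> * W t \<omega>)) - (f (R x) - f x) * p\<bar>
    \<le> (e + 4 * C * prob (wild \<rho> t)) * p + 4 * C * (r * t)\<^sup>2"
proof -
  let ?A = "{\<omega> \<in> space M. \<tau> 0 \<omega> \<le> t}" and ?A1 = "{\<omega> \<in> space M. \<tau> 1 \<omega> \<le> t}"
  let ?g = "\<lambda>\<omega>. f (z x t \<omega>) - f (x + \<sigma> * W t \<omega>) - (f (R x) - f x) * indicat_real ?A \<omega>"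
  let ?b = "\<lambda>\<omega>. e * indicat_real ?A \<omega> + 4 * C * indicat_real (wild \<rho> t \<inter> ?A) \<omega> + 4 * C * indicat_real ?A1 \<omega>"
  have fz: "integrable M (\<lambda>\<omega>. f (z x t \<omega>))" and fW: "integrable M (\<lambda>\<omega>. f (x + \<sigma> * W t \<omega>))"
    using \<open>0 < t\<close> by (auto intro!: integrable_f measurable_z)
  have ind: "integrable M (indicat_real S)" if "S \<in> events" for S
    using that by (intro integrable_real_indicator) (auto simp: less_top[symmetric])
  have "AE \<omega> in M. \<bar>?g \<omega>\<bar> \<le> ?b \<omega>"
    using z_before_first_arrival[OF less_imp_le[OF \<open>0 < t\<close>], of x] z_after_first_arrival[of t x]
      not_wild[OF \<open>0 < t\<close>, of \<rho>] arrivals_increasing AE_space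
  proof eventually_elim
    case (elim \<omega>)
    show ?case
    proof (cases "\<tau> 0 \<omega> \<le> t")
      case False
      then show ?thesis
        using elim C_nonneg \<open>0 \<le> e\<close> by (auto simp: not_le)
    next
      case arrived: True
      have crude: "\<bar>f (z x t \<omega>) - f (x + \<sigma> * W t \<omega>) - (f (R x) - f x)\<bar> \<le> 4 * C"
        using f_bound[of "z x t \<omega>"] f_bound[of "x + \<sigma> * W t \<omega>"] f_bound[of "R x"] f_bound[of x]
        by linarith
      show ?thesis
      proof (cases "\<omega> \<in> wild \<rho> t \<or> \<tau> 1 \<omega> \<le> t")
        case True
        then show ?thesis
          using crude arrived elim(5) C_nonneg \<open>0 \<le> e\<close> by (auto simp: indicator_def)
      next
        case False
        let ?s = "\<tau> 0 \<omega>"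
        have W: "\<bar>W ?s \<omega>\<bar> \<le> \<rho>" "\<bar>W t \<omega>\<bar> \<le> \<rho>"
          using elim(3,4) False arrived \<open>0 < t\<close> by auto
        then have W\<sigma>: "\<bar>\<sigma> * W ?s \<omega>\<bar> \<le> \<sigma> * \<rho>" "\<bar>\<sigma> * W t \<omega>\<bar> \<le> \<sigma> * \<rho>"
          using \<sigma>_pos by (simp_all add: abs_mult)
        \<comment> \<open>What remains after the reset is an increment between two values in
          [-\<rho>, \<rho>], hence the factor 2.\<close>
        have "\<bar>\<sigma> * (W t \<omega> - W ?s \<omega>)\<bar> \<le> 2 * (\<sigma> * \<rho>)"
          using W\<sigma> unfolding right_diff_distrib by linarith
        then have "\<bar>f (z x t \<omega>) - f (R x)\<bar> \<le> e / 2"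
          using elim(2) arrived False reset_close[of "x + \<sigma> * W ?s \<omega>"] W\<sigma>(1) by simp
        moreover have "\<bar>f (x + \<sigma> * W t \<omega>) - f x\<bar> \<le> e / 2"
          using close W\<sigma>(2) by simp
        ultimately have "\<bar>f (z x t \<omega>) - f (x + \<sigma> * W t \<omega>) - (f (R x) - f x)\<bar> \<le> e"
          by linarith
        then show ?thesis
          using arrived False elim(5) by simp
      qed
    qed
  qed
  then have "\<bar>expectation ?g\<bar> \<le> expectation ?b"
    using fz fW ind by (intro abs_integral_le_AE) auto
  also have "expectation ?b = e * p + 4 * C * prob (wild \<rho> t \<inter> ?A) + 4 * C * prob ?A1"
    using ind by (simp add: p_def)
  also have "\<dots> \<le> e * p + 4 * C * (prob (wild \<rho> t) * p) + 4 * C * (r * t)\<^sup>2"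
    using prob_second_arrival_le[of t] \<open>0 < t\<close> \<open>0 \<le> e\<close> C_nonneg prob_wild_and_first_arrival
    by (intro add_mono mult_left_mono) (auto simp: p_def)
  also have "expectation ?g = expectation (\<lambda>\<omega>. f (z x t \<omega>)) - expectation (\<lambda>\<omega>. f (x + \<sigma> * W t \<omega>))
      - (f (R x) - f x) * p"
    using fz fW ind by (simp add: p_def)
  finally show ?thesis
    by (simp add: algebra_simps)
qed

lemma jump_limit:
  assumes x: "x \<noteq> \<gamma> + \<delta>" "x \<noteq> - (\<gamma> + \<delta>)"
  shows "(\<lambda>n. (expectation (\<lambda>\<omega>. f (z x (1 / real (Suc n)) \<omega>))
      - expectation (\<lambda>\<omega>. f (x + \<sigma> * W (1 / real (Suc n)) \<omega>))) / (1 / real (Suc n)))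
    \<longlonglongrightarrow> r * (f (R x) - f x)"
proof -
  define t where "t n = 1 / real (Suc n)" for n
  define p where "p n = prob {\<omega> \<in> space M. \<tau> 0 \<omega> \<le> t n}" for n
  define E where "E n = expectation (\<lambda>\<omega>. f (z x (t n) \<omega>)) - expectation (\<lambda>\<omega>. f (x + \<sigma> * W (t n) \<omega>))" for n
  have t: "0 < t n" for n by (simp add: t_def)
  have t0: "t \<longlonglongrightarrow> 0"
    unfolding t_def[abs_def] by (rule LIMSEQ_Suc[OF lim_1_over_n])
  have tr: "filterlim t (at_right 0) sequentially"
    using t t0 by (auto simp: filterlim_at less_imp_neq[symmetric])
  have "((\<lambda>t. (1 - exp (- t * r)) / t) \<longlongrightarrow> r) (at 0)"
  proof -
    have "((\<lambda>t. 1 - exp (- t * r)) has_real_derivative r) (at 0)"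
      by (auto intro!: derivative_eq_intros)
    then show ?thesis by (simp add: DERIV_def)
  qed
  then have "((\<lambda>t. (1 - exp (- t * r)) / t) \<longlongrightarrow> r) (at_right 0)"
    by (simp add: filterlim_at_split)
  from filterlim_compose[OF this tr] have p: "(\<lambda>n. p n / t n) \<longlonglongrightarrow> r"
    using t by (simp add: p_def prob_first_arrival less_imp_le)
  have "(\<lambda>n. E n / t n - (f (R x) - f x) * (p n / t n)) \<longlonglongrightarrow> 0"
  proof (rule LIMSEQ_I)
    fix \<epsilon> :: real assume "0 < \<epsilon>"
    \<comment> \<open>In the error e is multiplied by p n / t n, which tends to r, and e r is half
      of \<epsilon>.\<close>
    define e where "e = \<epsilon> / (2 * r)"
    have e: "0 < e" "e * r < \<epsilon>" using \<open>0 < \<epsilon>\<close> r_pos by (simp_all add: e_def)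
    have "\<exists>d>0. \<forall>v. \<bar>v - u\<bar> < d \<longrightarrow> \<bar>f v - f u\<bar> \<le> e / 2" for u
    proof -
      have "0 < e / 2" using e(1) by simp
      with f_isCont[of u, unfolded continuous_at_eps_delta] obtain d
        where "0 < d" "\<forall>v. dist v u < d \<longrightarrow> dist (f v) (f u) < e / 2" by blast
      then show ?thesis by (auto simp: dist_real_def intro!: exI[of _ d] less_imp_le)
    qed
    then obtain d1 d2 where d1: "0 < d1" "\<And>v. \<bar>v - R x\<bar> < d1 \<Longrightarrow> \<bar>f v - f (R x)\<bar> \<le> e / 2"
      and d2: "0 < d2" "\<And>v. \<bar>v - x\<bar> < d2 \<Longrightarrow> \<bar>f v - f x\<bar> \<le> e / 2" by meson
    obtain d3 where d3: "0 < d3" "\<And>y. \<bar>y - x\<bar> < d3 \<Longrightarrow> \<bar>R y - R x\<bar> \<le> \<bar>y - x\<bar>"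
      by (rule reset_near[OF x]) blast
    \<comment> \<open>The point \<open>R y + h\<close> is within 3 \<sigma> \<rho> of
      \<open>R x\<close>; the 4 makes this strictly smaller than d1.\<close>
    define \<rho> where "\<rho> = min d1 (min d2 d3) / (4 * \<sigma>)"
    have \<rho>: "0 < \<rho>" "4 * (\<sigma> * \<rho>) \<le> d1" "4 * (\<sigma> * \<rho>) \<le> d2" "4 * (\<sigma> * \<rho>) \<le> d3" "0 < \<sigma> * \<rho>"
      using d1(1) d2(1) d3(1) \<sigma>_pos by (simp_all add: \<rho>_def)
    have reset_close: "\<bar>f (R y + h) - f (R x)\<bar> \<le> e / 2"
      if "\<bar>y - x\<bar> \<le> \<sigma> * \<rho>" "\<bar>h\<bar> \<le> 2 * (\<sigma> * \<rho>)" for y h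
      using that d3(2)[of y] \<rho> by (intro d1(2)) linarith
    have close: "\<bar>f y - f x\<bar> \<le> e / 2" if "\<bar>y - x\<bar> \<le> \<sigma> * \<rho>" for y
      using that \<rho> by (intro d2(2)) linarith
    \<comment> \<open>After division by t n the wild term still has a factor tending to 0, and the
      two-arrival term still has one factor t n.\<close>
    have "(\<lambda>n. (e + 4 * C * prob (wild \<rho> (t n))) * (p n / t n) + 4 * C * r\<^sup>2 * t n)
        \<longlonglongrightarrow> (e + 4 * C * 0) * r + 4 * C * r\<^sup>2 * 0"
      using prob_wild_tendsto[OF \<rho>(1)] p t0 unfolding t_def[symmetric] by (intro tendsto_intros)
    then have "\<forall>\<^sub>F n in sequentially.
        (e + 4 * C * prob (wild \<rho> (t n))) * (p n / t n) + 4 * C * r\<^sup>2 * t n < \<epsilon>"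
      using e(2) by (intro order_tendstoD) auto
    then have "\<forall>\<^sub>F n in sequentially. norm (E n / t n - (f (R x) - f x) * (p n / t n) - 0) < \<epsilon>"
    proof eventually_elim
      case (elim n)
      have "E n / t n - (f (R x) - f x) * (p n / t n) = (E n - (f (R x) - f x) * p n) / t n"
        by (simp add: diff_divide_distrib)
      then have "norm (E n / t n - (f (R x) - f x) * (p n / t n) - 0)
          = \<bar>E n - (f (R x) - f x) * p n\<bar> / t n"
        using t[of n] by simp
      also have "\<dots> \<le> ((e + 4 * C * prob (wild \<rho> (t n))) * p n + 4 * C * (r * t n)\<^sup>2) / t n"
        using jump_estimate[OF t[of n] less_imp_le[OF e(1)] reset_close close] t[of n]
        unfolding E_def p_def by (intro divide_right_mono) auto
      also have "\<dots> = (e + 4 * C * prob (wild \<rho> (t n))) * (p n / t n) + 4 * C * r\<^sup>2 * t n"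
        using t[of n] by (simp add: add_divide_distrib power2_eq_square)
      finally show ?case using elim by linarith
    qed
    then show "\<exists>no. \<forall>n\<ge>no. norm (E n / t n - (f (R x) - f x) * (p n / t n) - 0) < \<epsilon>"
      by (simp add: eventually_sequentially)
  qed
  from tendsto_add[OF this tendsto_mult_left[OF p, of "f (R x) - f x"]]
  show ?thesis
    by (simp add: E_def t_def mult.commute)
qed

section \<open>The generator under an invariant distribution\<close>

lemma generator_limit:
  assumes "x \<noteq> \<gamma> + \<delta>" "x \<noteq> - (\<gamma> + \<delta>)" and deriv2: "(f' has_real_derivative D) (at x)"
  shows "(\<lambda>n. (expectation (\<lambda>\<omega>. f (z x (1 / real (Suc n)) \<omega>)) - f x) / (1 / real (Suc n)))
    \<longlonglongrightarrow> \<sigma>\<^sup>2 / 2 * D + r * (f (R x) - f x)"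
proof -
  have "filterlim (\<lambda>n. 1 / real (Suc n)) (at_right 0) sequentially"
    using LIMSEQ_Suc[OF lim_1_over_n] by (auto simp: filterlim_at)
  from tendsto_add[OF filterlim_compose[OF diffusion_limit[OF deriv2] this] jump_limit[OF assms(1,2)]]
  show ?thesis
    by (simp add: add_divide_distrib[symmetric] distrib_right[symmetric] del: of_nat_Suc)
qed

text \<open>Uniform in x and t, hence a constant majorant for dominated convergence.\<close>

lemma generator_bound:
  assumes "0 < t"
  shows "\<bar>(expectation (\<lambda>\<omega>. f (z x t \<omega>)) - f x) / t\<bar> \<le> K * \<sigma>\<^sup>2 + 2 * C * r"
proof -
  have "\<bar>expectation (\<lambda>\<omega>. f (z x t \<omega>)) - f x\<bar> \<le> (K * \<sigma>\<^sup>2 + 2 * C * r) * t"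
    using diffusion_bound[OF assms, of x] jump_bound[of t x] assms
    unfolding distrib_right mult.assoc[of _ r t] by linarith
  then show ?thesis
    using assms by (simp add: divide_le_eq)
qed

end

text \<open>For each t, invariance makes the difference quotient of x \<mapsto> E f(z_t) integrate
  to 0, and this passes to the limit along t = 1/(n+1). The function g agrees with the generator
  image off the thresholds; at the thresholds, a null set, its values are free.\<close>

lemma integral_generator_eq_0:
  fixes f f' g :: "real \<Rightarrow> real"
  assumes inv: "invariant_distribution M z \<pi>"
    and f_bound: "\<And>y. \<bar>f y\<bar> \<le> C" and f_deriv: "\<And>y. (f has_real_derivative f' y) (at y)"
    and f'_lip: "\<And>y y'. \<bar>f' y - f' y'\<bar> \<le> K * \<bar>y - y'\<bar>"
    and g: "g \<in> borel_measurable borel"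
    and null: "AE x in \<pi>. x \<noteq> \<gamma> + \<delta> \<and> x \<noteq> - (\<gamma> + \<delta>)"
    and gen: "\<And>x. x \<noteq> \<gamma> + \<delta> \<Longrightarrow> x \<noteq> - (\<gamma> + \<delta>) \<Longrightarrow>
      \<exists>D. (f' has_real_derivative D) (at x) \<and> g x = \<sigma>\<^sup>2 / 2 * D + r * (f (R x) - f x)"
  shows "(\<integral>x. g x \<partial>\<pi>) = 0"
proof -
  note f = f_bound f_deriv f'_lip
  have \<pi>: "prob_space \<pi>" "sets \<pi> = sets borel"
    and kernel: "\<And>t A. 0 \<le> t \<Longrightarrow> A \<in> sets borel \<Longrightarrow>
      (\<integral>\<^sup>+ x. emeasure (distr M borel (z x t)) A \<partial>\<pi>) = emeasure \<pi> A"
    using inv by (auto simp: invariant_distribution_def)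
  interpret \<pi>: prob_space \<pi> by fact
  interpret c\<pi>: prob_space "completion \<pi>"
    by (rule prob_spaceI) (simp add: \<pi>.emeasure_space_1)
  have fm: "f \<in> borel_measurable borel" by (rule f_measurable[OF f])
  define t where "t n = 1 / real (Suc n)" for n
  have t: "0 < t n" for n by (simp add: t_def)
  define s where "s n x = (expectation (\<lambda>\<omega>. f (z x (t n) \<omega>)) - f x) / t n" for n x
  have zn: "z x (t n) \<in> borel_measurable M" for x n
    using measurable_z t less_imp_le by blast
  have E: "(\<lambda>x. expectation (\<lambda>\<omega>. f (z x (t n) \<omega>))) \<in> borel_measurable (completion \<pi>)"
    "(\<integral>x. expectation (\<lambda>\<omega>. f (z x (t n) \<omega>)) \<partial>completion \<pi>) = (\<integral>x. f x \<partial>\<pi>)" for n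
    using integral_invariant_kernel[where K = "\<lambda>x. distr M borel (z x (t n))",
        OF \<pi> prob_space_distr[OF zn] sets_distr kernel[OF less_imp_le[OF t]] fm f_bound]
    by (simp_all add: integral_distr[OF zn fm])
  have fc: "f \<in> borel_measurable (completion \<pi>)" and gc: "g \<in> borel_measurable (completion \<pi>)"
    using fm g \<pi>(2) measurable_completion by (metis measurable_cong_sets)+
  have s_meas: "s n \<in> borel_measurable (completion \<pi>)" for n
    unfolding s_def[abs_def] using E(1) fc by measurable
  have "(\<integral>x. s n x \<partial>completion \<pi>) = 0" for n
  proof -
    have "integrable (completion \<pi>) (\<lambda>x. expectation (\<lambda>\<omega>. f (z x (t n) \<omega>)))"
    proof (rule c\<pi>.integrable_const_bound[where B = C])
      have "\<bar>expectation (\<lambda>\<omega>. f (z x (t n) \<omega>))\<bar> \<le> (\<integral>\<omega>. C \<partial>M)" for x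
        using f_bound integrable_f[OF f zn] by (intro abs_integral_le_AE) auto
      then show "AE x in completion \<pi>. norm (expectation (\<lambda>\<omega>. f (z x (t n) \<omega>))) \<le> C"
        by (simp add: prob_space)
    qed (rule E(1))
    moreover have "integrable (completion \<pi>) f"
      using f_bound fc by (intro c\<pi>.integrable_const_bound[where B = C]) auto
    moreover have "(\<integral>x. f x \<partial>completion \<pi>) = (\<integral>x. f x \<partial>\<pi>)"
      using fm \<pi>(2) by (intro integral_completion) (simp cong: measurable_cong_sets)
    ultimately show ?thesis
      unfolding s_def by (simp add: E(2))
  qed
  moreover have "(\<lambda>n. \<integral>x. s n x \<partial>completion \<pi>) \<longlonglongrightarrow> (\<integral>x. g x \<partial>completion \<pi>)"
  proof (rule integral_dominated_convergence)
    show "AE x in completion \<pi>. (\<lambda>n. s n x) \<longlonglongrightarrow> g x"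
      using AE_completion[OF null]
    proof eventually_elim
      case (elim x)
      then obtain D where D: "(f' has_real_derivative D) (at x)" "g x = \<sigma>\<^sup>2 / 2 * D + r * (f (R x) - f x)"
        using gen by blast
      show ?case
        using generator_limit[OF f conjunct1[OF elim] conjunct2[OF elim] D(1)]
        unfolding s_def t_def D(2) .
    qed
    show "AE x in completion \<pi>. norm (s n x) \<le> K * \<sigma>\<^sup>2 + 2 * C * r" for n
      unfolding s_def real_norm_def using generator_bound[OF f t] by (intro AE_I2)
    show "integrable (completion \<pi>) (\<lambda>x. K * \<sigma>\<^sup>2 + 2 * C * r)" by simp
  qed (use gc s_meas in auto)
  ultimately have "(\<integral>x. g x \<partial>completion \<pi>) = 0"
    by (simp add: LIMSEQ_const_iff)
  then show ?thesis
    using g \<pi>(2) by (subst (asm) integral_completion) (simp_all cong: measurable_cong_sets)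
qed

text \<open>Until the first arrival z has a Gaussian law, so it sits at a at time t with probability
  at most that of an arrival by t, which is at most r t for every starting point. Invariance
  transfers the bound to \<pi>, and t is arbitrary.\<close>

lemma invariant_distribution_no_atoms:
  assumes inv: "invariant_distribution M z \<pi>"
  shows "AE x in \<pi>. x \<noteq> a"
proof -
  have \<pi>: "prob_space \<pi>" "sets \<pi> = sets borel"
    and kernel: "\<And>t A. 0 \<le> t \<Longrightarrow> A \<in> sets borel \<Longrightarrow>
      (\<integral>\<^sup>+ x. emeasure (distr M borel (z x t)) A \<partial>\<pi>) = emeasure \<pi> A"
    using inv by (auto simp: invariant_distribution_def)
  interpret \<pi>: prob_space \<pi> by fact
  have le: "measure \<pi> {a} \<le> r * t" if "0 < t" for t
  proof -
    have zt: "z x t \<in> borel_measurable M" for x using measurable_z that by simp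
    have "emeasure (distr M borel (z x t)) {a} \<le> ennreal (r * t)" for x
    proof -
      \<comment> \<open>The value of \<open>W t\<close> at which the undisturbed path is at
        a.\<close>
      let ?c = "(a - x) / \<sigma>"
      have "emeasure M (W t -` {?c} \<inter> space M) = 0"
        using distributed_emeasure[OF distributed_W[OF that], of "{?c}"] by simp
      then have "W t -` {?c} \<inter> space M \<in> null_sets M"
        using that by (auto intro!: null_setsI measurable_sets[of _ _ borel])
      from AE_not_in[OF this] have "AE \<omega> in M. \<omega> \<in> z x t -` {a} \<inter> space M \<longrightarrow> \<omega> \<in> {\<omega> \<in> space M. \<tau> 0 \<omega> \<le> t}"
        using z_before_first_arrival[OF less_imp_le[OF that], of x]
      proof eventually_elim
        case (elim \<omega>)
        then show ?case using \<sigma>_pos by (cases "t < \<tau> 0 \<omega>") auto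
      qed
      then have "emeasure M (z x t -` {a} \<inter> space M) \<le> emeasure M {\<omega> \<in> space M. \<tau> 0 \<omega> \<le> t}"
        by (intro emeasure_mono_AE) auto
      also have "\<dots> \<le> ennreal (r * t)"
        using prob_first_arrival_le[of t] that by (simp add: emeasure_eq_measure ennreal_leI)
      finally show ?thesis using zt by (simp add: emeasure_distr)
    qed
    then have "(\<integral>\<^sup>+ x. emeasure (distr M borel (z x t)) {a} \<partial>\<pi>) \<le> (\<integral>\<^sup>+ x. ennreal (r * t) \<partial>\<pi>)"
      by (intro nn_integral_mono)
    then have "emeasure \<pi> {a} \<le> ennreal (r * t)"
      using kernel[of t "{a}"] that by (simp add: \<pi>.emeasure_space_1)
    then show ?thesis
      using that r_pos by (simp add: \<pi>.emeasure_eq_measure)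
  qed
  have "measure \<pi> {a} / r \<le> t" if "0 < t" for t
    using le[OF that] r_pos by (simp add: divide_le_eq mult.commute)
  then have "measure \<pi> {a} / r \<le> 0"
    by (rule dense_ge)
  then have "measure \<pi> {a} = 0"
    using r_pos measure_nonneg[of \<pi> "{a}"] by (simp add: divide_le_0_iff)
  then have "{a} \<in> null_sets \<pi>"
    using \<pi>(2) by (simp add: null_sets_def \<pi>.emeasure_eq_measure)
  from AE_not_in[OF this] show ?thesis by simp
qed

end

section \<open>Test functions and the tail probabilities\<close>

text \<open>Freezing g to the left of b preserves differentiability because g' vanishes at b. At the
  junction, the error bound for g on the right holds trivially on the left, where the increment is
  0.\<close>

lemma DERIV_clamped:
  fixes g g' :: "real \<Rightarrow> real"
  assumes deriv: "\<And>y. (g has_real_derivative g' y) (at y)" and "g' b = 0"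
  shows "((\<lambda>x. g (max x b)) has_real_derivative g' (max x b)) (at x)"
proof (cases x b rule: linorder_cases)
  case less
  then have "((\<lambda>_. g b) has_real_derivative g' (max x b)) (at x)"
    using \<open>g' b = 0\<close> by simp
  then show ?thesis
    by (rule has_field_derivative_transform_within_open[of _ _ _ "{..<b}"]) (use less in auto)
next
  case greater
  then have "(g has_real_derivative g' (max x b)) (at x)"
    using deriv[of x] by simp
  then show ?thesis
    by (rule has_field_derivative_transform_within_open[of _ _ _ "{b<..}"]) (use greater in auto)
next
  case equal
  have "\<exists>d>0. \<forall>y. \<bar>y - b\<bar> < d \<longrightarrow> \<bar>g (max y b) - g b\<bar> \<le> e * \<bar>y - b\<bar>" if "0 < e" for e
  proof -
    obtain d where d: "0 < d" "\<And>y. \<bar>y - b\<bar> < d \<Longrightarrow> \<bar>g y - g b\<bar> \<le> e * \<bar>y - b\<bar>"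
    proof -
      have "\<forall>e>0. \<exists>d>0. \<forall>y. \<bar>y - b\<bar> < d \<longrightarrow> \<bar>g y - g b\<bar> \<le> e * \<bar>y - b\<bar>"
        using deriv[of b] \<open>g' b = 0\<close>
        unfolding has_field_derivative_def has_derivative_at_alt by simp
      then show thesis using \<open>0 < e\<close> that by blast
    qed
    have "\<bar>g (max y b) - g b\<bar> \<le> e * \<bar>y - b\<bar>" if "\<bar>y - b\<bar> < d" for y
      using d(2)[OF that] \<open>0 < e\<close> by (cases "b \<le> y") auto
    then show ?thesis using d(1) by blast
  qed
  then show ?thesis
    unfolding has_field_derivative_def has_derivative_at_alt
    using equal \<open>g' b = 0\<close> by (auto simp: bounded_linear_mult_right)
qed

context mispricing
begin

definition b :: real where "b = \<gamma> + \<delta>"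

text \<open>The decay rate of the bounded exponential solutions of \<sigma>^2/2 f'' = r f. The
  product \<open>b * \<kappa>\<close> is the \<eta> of the model.\<close>

definition \<kappa> :: real where "\<kappa> = sqrt (2 * r) / \<sigma>"

lemma b_gt_\<gamma>: "\<gamma> < b" and b_pos: "0 < b"
  using \<gamma>_pos \<delta>_pos by (simp_all add: b_def)

lemma \<kappa>_pos: "0 < \<kappa>" and \<kappa>_squared: "\<sigma>\<^sup>2 * \<kappa>\<^sup>2 = 2 * r"
  using r_pos \<sigma>_pos by (simp_all add: \<kappa>_def power_divide)

text \<open>The test functions equal \<open>\<alpha> x\<^sup>2 + \<beta> x\<close> on \<open>[- b, b]\<close> and are continued as bounded
  \<open>C\<^sup>1\<close> solutions of \<open>\<sigma>\<^sup>2/2 f'' - r f = const\<close> on either side, so that the generator maps them to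
  functions that are constant on each of the three pieces. The correction \<open>edge\<close> vanishes
  to first order at \<open>b\<close>.\<close>

definition edge :: "real \<Rightarrow> real \<Rightarrow> real \<Rightarrow> real" where
  "edge \<alpha> \<beta> y = (\<alpha> * b\<^sup>2 + \<beta> * b) - (\<alpha> * y\<^sup>2 + \<beta> * y)
     - (2 * \<alpha> * b + \<beta>) / \<kappa> * (exp (- \<kappa> * (y - b)) - 1)"

definition edge' :: "real \<Rightarrow> real \<Rightarrow> real \<Rightarrow> real" where
  "edge' \<alpha> \<beta> y = (2 * \<alpha> * b + \<beta>) * exp (- \<kappa> * (y - b)) - (2 * \<alpha> * y + \<beta>)"

definition edge'' :: "real \<Rightarrow> real \<Rightarrow> real \<Rightarrow> real" where
  "edge'' \<alpha> \<beta> y = - \<kappa> * (2 * \<alpha> * b + \<beta>) * exp (- \<kappa> * (y - b)) - 2 * \<alpha>"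

text \<open>The left continuation is the right one after the reflection x \<mapsto> -x, which
  changes the sign of \<beta>. Clamping switches each correction off on its own side of the
  threshold.\<close>

definition test :: "real \<Rightarrow> real \<Rightarrow> real \<Rightarrow> real" where
  "test \<alpha> \<beta> x = \<alpha> * x\<^sup>2 + \<beta> * x + edge \<alpha> \<beta> (max x b) + edge \<alpha> (- \<beta>) (max (- x) b)"

definition test' :: "real \<Rightarrow> real \<Rightarrow> real \<Rightarrow> real" where
  "test' \<alpha> \<beta> x = 2 * \<alpha> * x + \<beta> + edge' \<alpha> \<beta> (max x b) - edge' \<alpha> (- \<beta>) (max (- x) b)"

lemma edge_at_b [simp]: "edge \<alpha> \<beta> b = 0" "edge' \<alpha> \<beta> b = 0"
  by (simp_all add: edge_def edge'_def)

lemma DERIV_edge: "(edge \<alpha> \<beta> has_real_derivative edge' \<alpha> \<beta> y) (at y)"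
  unfolding edge_def[abs_def] edge'_def
  by (rule derivative_eq_intros refl | use \<kappa>_pos in \<open>simp add: field_simps\<close>)+

lemma DERIV_edge': "(edge' \<alpha> \<beta> has_real_derivative edge'' \<alpha> \<beta> y) (at y)"
  unfolding edge'_def[abs_def] edge''_def
  by (rule derivative_eq_intros refl | simp add: algebra_simps)+

lemma DERIV_test: "(test \<alpha> \<beta> has_real_derivative test' \<alpha> \<beta> x) (at x)"
proof -
  have left: "((\<lambda>x. edge \<alpha> (- \<beta>) (max (- x) b)) has_real_derivative edge' \<alpha> (- \<beta>) (max (- x) b) * - 1) (at x)"
    by (rule DERIV_chain2[where g = uminus, OF DERIV_clamped[OF DERIV_edge]])
      (auto intro!: derivative_eq_intros)
  have right: "((\<lambda>x. edge \<alpha> \<beta> (max x b)) has_real_derivative edge' \<alpha> \<beta> (max x b)) (at x)"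
    by (rule DERIV_clamped[OF DERIV_edge]) simp
  show ?thesis
    unfolding test_def[abs_def] test'_def
    by (rule derivative_eq_intros left right refl | simp)+
qed

lemma test_right:
  assumes "b \<le> x"
  shows "test \<alpha> \<beta> x = \<alpha> * b\<^sup>2 + \<beta> * b - (2 * \<alpha> * b + \<beta>) / \<kappa> * (exp (- \<kappa> * (x - b)) - 1)"
proof -
  have "max x b = x" "max (- x) b = b" using assms b_pos by auto
  then show ?thesis by (simp add: test_def edge_def)
qed

lemma test_left:
  assumes "x \<le> - b"
  shows "test \<alpha> \<beta> x = \<alpha> * b\<^sup>2 - \<beta> * b - (2 * \<alpha> * b - \<beta>) / \<kappa> * (exp (- \<kappa> * (- x - b)) - 1)"
proof -
  have "max x b = b" "max (- x) b = - x" using assms b_pos by auto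
  then show ?thesis by (simp add: test_def edge_def)
qed

lemma test_middle:
  assumes "\<bar>x\<bar> \<le> b"
  shows "test \<alpha> \<beta> x = \<alpha> * x\<^sup>2 + \<beta> * x"
proof -
  have "max x b = b" "max (- x) b = b" using assms by auto
  then show ?thesis by (simp add: test_def)
qed

lemma test_bound: "\<bar>test \<alpha> \<beta> x\<bar> \<le> \<bar>\<alpha>\<bar> * b\<^sup>2 + \<bar>\<beta>\<bar> * b + (2 * \<bar>\<alpha>\<bar> * b + \<bar>\<beta>\<bar>) / \<kappa>"
proof -
  have tail: "\<bar>\<alpha> * b\<^sup>2 + \<beta> * b - (2 * \<alpha> * b + \<beta>) / \<kappa> * (exp (- \<kappa> * y) - 1)\<bar>
      \<le> \<bar>\<alpha>\<bar> * b\<^sup>2 + \<bar>\<beta>\<bar> * b + (2 * \<bar>\<alpha>\<bar> * b + \<bar>\<beta>\<bar>) / \<kappa>" if "0 \<le> y" for \<beta> y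
  proof -
    have "\<bar>exp (- \<kappa> * y) - 1\<bar> \<le> 1" using that \<kappa>_pos by simp
    moreover have "\<bar>(2 * \<alpha> * b + \<beta>) / \<kappa>\<bar> \<le> (2 * \<bar>\<alpha>\<bar> * b + \<bar>\<beta>\<bar>) / \<kappa>"
      using \<kappa>_pos b_pos abs_triangle_ineq[of "2 * \<alpha> * b" \<beta>]
      by (simp add: abs_mult divide_right_mono)
    ultimately have "\<bar>(2 * \<alpha> * b + \<beta>) / \<kappa> * (exp (- \<kappa> * y) - 1)\<bar> \<le> (2 * \<bar>\<alpha>\<bar> * b + \<bar>\<beta>\<bar>) / \<kappa> * 1"
      unfolding abs_mult using \<kappa>_pos b_pos by (intro mult_mono) auto
    moreover have "\<bar>\<alpha> * b\<^sup>2 + \<beta> * b\<bar> \<le> \<bar>\<alpha>\<bar> * b\<^sup>2 + \<bar>\<beta>\<bar> * b"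
      using b_pos abs_triangle_ineq[of "\<alpha> * b\<^sup>2" "\<beta> * b"] by (simp add: abs_mult)
    ultimately show ?thesis by linarith
  qed
  consider "b \<le> x" | "x \<le> - b" | "\<bar>x\<bar> \<le> b" by linarith
  then show ?thesis
  proof cases
    case 1
    then show ?thesis using tail[of "x - b" \<beta>] by (simp add: test_right)
  next
    case 2
    then show ?thesis using tail[of "- x - b" "- \<beta>"] by (simp add: test_left)
  next
    case 3
    have "\<bar>\<alpha> * x\<^sup>2 + \<beta> * x\<bar> \<le> \<bar>\<alpha>\<bar> * \<bar>x\<bar>\<^sup>2 + \<bar>\<beta>\<bar> * \<bar>x\<bar>"
      using abs_triangle_ineq[of "\<alpha> * x\<^sup>2" "\<beta> * x"] by (simp add: abs_mult)
    also have "\<dots> \<le> \<bar>\<alpha>\<bar> * b\<^sup>2 + \<bar>\<beta>\<bar> * b"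
      using 3 by (intro add_mono mult_left_mono power_mono) auto
    also have "\<dots> \<le> \<bar>\<alpha>\<bar> * b\<^sup>2 + \<bar>\<beta>\<bar> * b + (2 * \<bar>\<alpha>\<bar> * b + \<bar>\<beta>\<bar>) / \<kappa>"
      using \<kappa>_pos b_pos by simp
    finally show ?thesis using 3 by (simp add: test_middle)
  qed
qed

text \<open>The exponential in \<open>edge''\<close> is bounded only on [b, \<infinity>), which is
  where clamping keeps the arguments; clamping itself does not increase distances.\<close>

lemma edge'_clamped_lipschitz:
  "\<bar>edge' \<alpha> \<beta> (max x b) - edge' \<alpha> \<beta> (max y b)\<bar> \<le> (\<kappa> * \<bar>2 * \<alpha> * b + \<beta>\<bar> + 2 * \<bar>\<alpha>\<bar>) * \<bar>x - y\<bar>"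
    (is "_ \<le> ?L * _")
proof -
  have "norm (edge'' \<alpha> \<beta> y) \<le> ?L" if "y \<in> {b..}" for y
  proof -
    have "\<bar>\<kappa> * (2 * \<alpha> * b + \<beta>) * exp (- \<kappa> * (y - b))\<bar> \<le> \<kappa> * \<bar>2 * \<alpha> * b + \<beta>\<bar> * 1"
      unfolding abs_mult using that \<kappa>_pos by (intro mult_mono) auto
    then show ?thesis
      by (auto simp: edge''_def)
  qed
  then have "norm (edge' \<alpha> \<beta> (max x b) - edge' \<alpha> \<beta> (max y b)) \<le> ?L * norm (max x b - max y b)"
    using DERIV_edge' by (intro field_differentiable_bound[where S = "{b..}" and f' = "edge'' \<alpha> \<beta>"])
      (auto intro: has_field_derivative_at_within)
  also have "\<dots> \<le> ?L * \<bar>x - y\<bar>"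
    using \<kappa>_pos by (intro mult_left_mono) auto
  finally show ?thesis by simp
qed

lemma test'_lipschitz:
  obtains K where "\<And>x y. \<bar>test' \<alpha> \<beta> x - test' \<alpha> \<beta> y\<bar> \<le> K * \<bar>x - y\<bar>"
proof
  let ?L = "\<lambda>\<beta>. \<kappa> * \<bar>2 * \<alpha> * b + \<beta>\<bar> + 2 * \<bar>\<alpha>\<bar>"
  fix x y
  define u where "u = edge' \<alpha> \<beta> (max x b) - edge' \<alpha> \<beta> (max y b)"
  define v where "v = edge' \<alpha> (- \<beta>) (max (- x) b) - edge' \<alpha> (- \<beta>) (max (- y) b)"
  have "test' \<alpha> \<beta> x - test' \<alpha> \<beta> y = 2 * \<alpha> * (x - y) + u - v"
    by (simp add: test'_def u_def v_def algebra_simps)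
  also have "\<bar>\<dots>\<bar> \<le> 2 * \<bar>\<alpha>\<bar> * \<bar>x - y\<bar> + \<bar>u\<bar> + \<bar>v\<bar>"
    using abs_triangle_ineq[of "2 * \<alpha> * (x - y) + u" "- v"] abs_triangle_ineq[of "2 * \<alpha> * (x - y)" u]
    by (simp add: abs_mult)
  also have "\<dots> \<le> 2 * \<bar>\<alpha>\<bar> * \<bar>x - y\<bar> + ?L \<beta> * \<bar>x - y\<bar> + ?L (- \<beta>) * \<bar>x - y\<bar>"
    using edge'_clamped_lipschitz[of \<alpha> \<beta> x y] edge'_clamped_lipschitz[of \<alpha> "- \<beta>" "- x" "- y"]
    unfolding u_def v_def by (intro add_mono) (simp_all add: abs_minus_commute)
  finally show "\<bar>test' \<alpha> \<beta> x - test' \<alpha> \<beta> y\<bar> \<le> (2 * \<bar>\<alpha>\<bar> + ?L \<beta> + ?L (- \<beta>)) * \<bar>x - y\<bar>"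
    by (simp only: distrib_right)
qed

text \<open>The constant value of the generator on the right tail: r times the difference between
  the test function at \<gamma> and its limit at infinity, where f'' has died out. The left tail has
  -\<beta> for \<beta>.\<close>

definition generator_tail :: "real \<Rightarrow> real \<Rightarrow> real" where
  "generator_tail \<alpha> \<beta> = r * (\<alpha> * (\<gamma>\<^sup>2 - b\<^sup>2) + \<beta> * (\<gamma> - b) - (2 * \<alpha> * b + \<beta>) / \<kappa>)"

text \<open>Here e stands for the exponential. It cancels because \<sigma>^2 \<kappa> / 2 = r /
  \<kappa>, which is what fixes the choice of \<kappa>.\<close>

lemma tail_equation:
  "\<sigma>\<^sup>2 / 2 * (- \<kappa> * (2 * \<alpha> * b + \<beta>) * e)
     + r * (\<alpha> * \<gamma>\<^sup>2 + \<beta> * \<gamma> - (\<alpha> * b\<^sup>2 + \<beta> * b - (2 * \<alpha> * b + \<beta>) / \<kappa> * (e - 1)))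
   = generator_tail \<alpha> \<beta>"
proof -
  have "\<sigma>\<^sup>2 / 2 * \<kappa> = r / \<kappa>"
    using \<kappa>_squared \<kappa>_pos by (simp add: field_simps power2_eq_square)
  then have "\<sigma>\<^sup>2 / 2 * (- \<kappa> * (2 * \<alpha> * b + \<beta>) * e) = - (r / \<kappa> * (2 * \<alpha> * b + \<beta>) * e)"
    by (metis (no_types, opaque_lifting) mult.assoc mult_minus_left mult_minus_right)
  then show ?thesis
    unfolding generator_tail_def by (simp add: algebra_simps diff_divide_distrib add_divide_distrib)
qed

text \<open>Between the thresholds R is the identity, so only \<sigma>^2/2 times 2 \<alpha> remains.
  From the tails R leads to \<gamma> or -\<gamma>, where the test function is still the
  quadratic.\<close>

lemma generator_test:
  assumes "x \<noteq> \<gamma> + \<delta>" "x \<noteq> - (\<gamma> + \<delta>)"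
  shows "\<exists>D. (test' \<alpha> \<beta> has_real_derivative D) (at x) \<and>
    \<sigma>\<^sup>2 * \<alpha> + (generator_tail \<alpha> \<beta> - \<sigma>\<^sup>2 * \<alpha>) * indicator {\<gamma> + \<delta><..} x
      + (generator_tail \<alpha> (- \<beta>) - \<sigma>\<^sup>2 * \<alpha>) * indicator {..<- (\<gamma> + \<delta>)} x
    = \<sigma>\<^sup>2 / 2 * D + r * (test \<alpha> \<beta> (R x) - test \<alpha> \<beta> x)"
proof -
  have test_\<gamma>: "test \<alpha> \<beta> \<gamma> = \<alpha> * \<gamma>\<^sup>2 + \<beta> * \<gamma>" "test \<alpha> \<beta> (- \<gamma>) = \<alpha> * \<gamma>\<^sup>2 - \<beta> * \<gamma>"
    using b_gt_\<gamma> \<gamma>_pos by (simp_all add: test_middle)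
  have "b < x \<or> x < - b \<or> \<bar>x\<bar> < b"
    using assms unfolding b_def by linarith
  then consider "b < x" | "x < - b" | "\<bar>x\<bar> < b" by blast
  then show ?thesis
  proof cases
    case 1
    let ?D = "- \<kappa> * (2 * \<alpha> * b + \<beta>) * exp (- \<kappa> * (x - b))"
    have "(test' \<alpha> \<beta> has_real_derivative ?D) (at x)"
    proof (rule has_field_derivative_transform_within_open[of "\<lambda>x. 2 * \<alpha> * x + \<beta> + edge' \<alpha> \<beta> x" _ _ "{b<..}"])
      show "((\<lambda>x. 2 * \<alpha> * x + \<beta> + edge' \<alpha> \<beta> x) has_real_derivative ?D) (at x)"
        by (rule derivative_eq_intros DERIV_edge' refl | simp add: edge''_def)+
    qed (use 1 b_pos in \<open>auto simp: test'_def max_def\<close>)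
    moreover have "R x = \<gamma>" using 1 by (simp add: reset_def b_def)
    ultimately show ?thesis
      using 1 b_pos tail_equation[of \<alpha> \<beta> "exp (- \<kappa> * (x - b))"] unfolding b_def[symmetric]
      by (intro exI[of _ ?D]) (simp add: test_\<gamma> test_right)
  next
    case 2
    let ?D = "- \<kappa> * (2 * \<alpha> * b - \<beta>) * exp (- \<kappa> * (- x - b))"
    have "(test' \<alpha> \<beta> has_real_derivative ?D) (at x)"
    proof (rule has_field_derivative_transform_within_open[of "\<lambda>x. 2 * \<alpha> * x + \<beta> - edge' \<alpha> (- \<beta>) (- x)" _ _ "{..<- b}"])
      have dE: "((\<lambda>x. edge' \<alpha> (- \<beta>) (- x)) has_real_derivative edge'' \<alpha> (- \<beta>) (- x) * - 1) (at x)"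
        by (rule DERIV_chain2[OF DERIV_edge']) (auto intro!: derivative_eq_intros)
      show "((\<lambda>x. 2 * \<alpha> * x + \<beta> - edge' \<alpha> (- \<beta>) (- x)) has_real_derivative ?D) (at x)"
        by (rule derivative_eq_intros dE refl | simp add: edge''_def)+
    qed (use 2 b_pos in \<open>auto simp: test'_def max_def\<close>)
    moreover have "R x = - \<gamma>" using 2 b_pos by (simp add: reset_def b_def)
    ultimately show ?thesis
      using 2 b_pos tail_equation[of \<alpha> "- \<beta>" "exp (- \<kappa> * (- x - b))"] unfolding b_def[symmetric]
      by (intro exI[of _ ?D]) (simp add: test_\<gamma> test_left)
  next
    case 3
    have "(test' \<alpha> \<beta> has_real_derivative 2 * \<alpha>) (at x)"
    proof (rule has_field_derivative_transform_within_open[of "\<lambda>x. 2 * \<alpha> * x + \<beta>" _ _ "{-b<..<b}"])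
      show "((\<lambda>x. 2 * \<alpha> * x + \<beta>) has_real_derivative 2 * \<alpha>) (at x)"
        by (rule derivative_eq_intros refl | simp)+
    qed (use 3 in \<open>auto simp: test'_def max_def\<close>)
    moreover have "R x = x" using 3 by (auto simp: reset_def b_def)
    ultimately show ?thesis
      using 3 unfolding b_def[symmetric] by (intro exI[of _ "2 * \<alpha>"]) simp
  qed
qed

section \<open>The tail probabilities from two test functions\<close>

lemma invariant_tails:
  assumes inv: "invariant_distribution M z \<pi>"
  defines "p \<equiv> measure \<pi> {\<gamma> + \<delta><..}" and "m \<equiv> measure \<pi> {..<- (\<gamma> + \<delta>)}"
  shows "\<sigma>\<^sup>2 * \<alpha> * (1 - p - m) + generator_tail \<alpha> \<beta> * p + generator_tail \<alpha> (- \<beta>) * m = 0"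
proof -
  have \<pi>: "prob_space \<pi>" "sets \<pi> = sets borel"
    using inv by (auto simp: invariant_distribution_def)
  interpret \<pi>: prob_space \<pi> by fact
  let ?I = "indicat_real {\<gamma> + \<delta><..}" and ?J = "indicat_real {..<- (\<gamma> + \<delta>)}"
  let ?g = "\<lambda>x. \<sigma>\<^sup>2 * \<alpha> + (generator_tail \<alpha> \<beta> - \<sigma>\<^sup>2 * \<alpha>) * ?I x
      + (generator_tail \<alpha> (- \<beta>) - \<sigma>\<^sup>2 * \<alpha>) * ?J x"
  obtain K where K: "\<And>x y. \<bar>test' \<alpha> \<beta> x - test' \<alpha> \<beta> y\<bar> \<le> K * \<bar>x - y\<bar>"
    by (rule test'_lipschitz) blast
  have null: "AE x in \<pi>. x \<noteq> \<gamma> + \<delta> \<and> x \<noteq> - (\<gamma> + \<delta>)"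
    using invariant_distribution_no_atoms[OF inv] by (intro AE_conjI)
  have "(\<integral>x. ?g x \<partial>\<pi>) = 0"
    by (rule integral_generator_eq_0[OF inv test_bound DERIV_test K _ null generator_test]) measurable
  moreover have "integrable \<pi> ?I" "integrable \<pi> ?J"
    using \<pi>(2) by (auto intro!: integrable_real_indicator simp: less_top[symmetric])
  moreover have "space \<pi> = UNIV"
    using sets_eq_imp_space_eq[OF \<pi>(2)] by simp
  ultimately have "\<sigma>\<^sup>2 * \<alpha> + (generator_tail \<alpha> \<beta> - \<sigma>\<^sup>2 * \<alpha>) * p + (generator_tail \<alpha> (- \<beta>) - \<sigma>\<^sup>2 * \<alpha>) * m = 0"
    using \<pi>.prob_space by (simp add: p_def m_def)
  then show ?thesis by (simp add: algebra_simps)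
qed

lemma invariant_tail_probabilities:
  assumes inv: "invariant_distribution M z \<pi>"
  shows "measure \<pi> {..<- (\<gamma> + \<delta>)} = measure \<pi> {\<gamma> + \<delta><..}"
    and "2 * r * measure \<pi> {\<gamma> + \<delta><..} = gas_K \<sigma> \<gamma> \<delta> r"
proof -
  let ?p = "measure \<pi> {\<gamma> + \<delta><..}" and ?m = "measure \<pi> {..<- (\<gamma> + \<delta>)}"
  note eq = invariant_tails[OF inv]
  \<comment> \<open>For the odd test function the middle contributes 0 and the tails carry opposite
    nonzero values, so the two tail probabilities agree.\<close>
  have neg: "generator_tail 0 (- 1) = - generator_tail 0 1"
    by (simp add: generator_tail_def algebra_simps)
  have "0 < r * ((b - \<gamma>) + 1 / \<kappa>)"
    using r_pos b_gt_\<gamma> \<kappa>_pos by (intro mult_pos_pos add_pos_pos) auto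
  then have "generator_tail 0 1 \<noteq> 0"
    by (simp add: generator_tail_def algebra_simps)
  moreover have "generator_tail 0 1 * (?p - ?m) = 0"
    using eq[of 0 1] unfolding neg by (simp add: algebra_simps)
  ultimately show mp: "?m = ?p" by simp
  \<comment> \<open>The even test function, x^2 in the middle, gives the remaining equation.
    Rewriting 2 r / \<kappa> as \<kappa> \<sigma>^2 makes \<sigma>^2 a common factor, and what is
    left is the denominator of K.\<close>
  have "2 * b / \<kappa> * r = b * \<kappa> * \<sigma>\<^sup>2"
    using \<kappa>_squared \<kappa>_pos by (simp add: field_simps power2_eq_square)
  then have tail: "generator_tail 1 0 = - (r * (b\<^sup>2 - \<gamma>\<^sup>2) + b * \<kappa> * \<sigma>\<^sup>2)"
    unfolding generator_tail_def by (simp add: algebra_simps)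
  have "\<sigma>\<^sup>2 = 2 * ?p * (\<sigma>\<^sup>2 + b * \<kappa> * \<sigma>\<^sup>2 + r * (b\<^sup>2 - \<gamma>\<^sup>2))"
    using eq[of 1 0] unfolding mp by (simp add: tail algebra_simps)
  also have "\<dots> = \<sigma>\<^sup>2 * (2 * ?p * (1 + b * \<kappa> + r * (b\<^sup>2 - \<gamma>\<^sup>2) / \<sigma>\<^sup>2))"
    using \<sigma>_pos by (simp add: field_simps)
  finally have one: "2 * ?p * (1 + b * \<kappa> + r * (b\<^sup>2 - \<gamma>\<^sup>2) / \<sigma>\<^sup>2) = 1"
    using \<sigma>_pos by simp
  then have "1 + b * \<kappa> + r * (b\<^sup>2 - \<gamma>\<^sup>2) / \<sigma>\<^sup>2 \<noteq> 0" by auto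
  with one have "2 * ?p = 1 / (1 + b * \<kappa> + r * (b\<^sup>2 - \<gamma>\<^sup>2) / \<sigma>\<^sup>2)"
    by (simp add: eq_divide_eq)
  then have "2 * r * ?p = r / (1 + b * \<kappa> + r * (b\<^sup>2 - \<gamma>\<^sup>2) / \<sigma>\<^sup>2)"
    by (metis mult.commute mult.left_commute times_divide_eq_right mult.right_neutral)
  then show "2 * r * ?p = gas_K \<sigma> \<gamma> \<delta> r"
    by (simp add: gas_K_def b_def \<kappa>_def)
qed

end

theorem corollary3:
  fixes \<sigma> r \<gamma> \<delta> P L :: real
    and M :: "'a measure"
    and B :: "real \<Rightarrow> 'a \<Rightarrow> real"
    and \<tau> :: "nat \<Rightarrow> 'a \<Rightarrow> real"
    and z :: "real \<Rightarrow> real \<Rightarrow> 'a \<Rightarrow> real"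
    and \<pi> :: "real measure"
    and f :: "real \<times> real \<Rightarrow> real"
    and xs ys :: "real \<Rightarrow> real"
  assumes "\<sigma> > 0" and "r > 0" and "\<gamma> > 0" and "\<delta> > 0" and "P > 0"
    and "mispricing_process \<sigma> r \<gamma> \<delta> M B \<tau> z"
    and "invariant_distribution M z \<pi>"
    and "\<forall>p\<ge>0. optimal_holdings f L p (xs p) (ys p)"
    and "pool_value f L C1_differentiable_on {0<..}"
    and "deriv (pool_value f L) C1_differentiable_on {0<..}"
  shows "gas_rate \<pi> xs ys P r \<gamma> \<delta> = gas_K \<sigma> \<gamma> \<delta> r * gas_G xs ys P \<gamma> \<delta>
    \<and> ((gas_K \<sigma> \<gamma> \<delta>) \<longlongrightarrow> \<sigma>\<^sup>2 / ((\<gamma> + \<delta>)\<^sup>2 - \<gamma>\<^sup>2)) at_top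
    \<and> ys differentiable (at (P * exp (- \<gamma>)))
    \<and> ys differentiable (at (P * exp \<gamma>))
    \<and> (\<lambda>d. gas_G xs ys P \<gamma> d
            - P * d\<^sup>2 / 2 * ((deriv ys (P * exp (- \<gamma>)) + exp \<gamma> * deriv ys (P * exp \<gamma>)) / 2))
         \<in> o[at_right 0](\<lambda>d. d\<^sup>2)"
proof -
  interpret mispricing \<sigma> r \<gamma> \<delta> M B \<tau> z
    using assms by unfold_locales auto
  obtain v where v: "continuous_on {0<..} v"
    and xs: "\<And>q. 0 < q \<Longrightarrow> (xs has_real_derivative v q) (at q)"
    and ys: "\<And>q. 0 < q \<Longrightarrow> (ys has_real_derivative - q * v q) (at q)"
    using holdings_have_derivatives[of f L xs ys] assms(8-10) by blast
  \<comment> \<open>Equal tails factor out of both costs; the 2 goes to the tail probability to form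
    K, and the mean of the two costs is G.\<close>
  have "gas_rate \<pi> xs ys P r \<gamma> \<delta>
      = 2 * r * measure \<pi> {\<gamma> + \<delta><..} * ((gas_plus xs ys P \<gamma> \<delta> + gas_minus xs ys P \<gamma> \<delta>) / 2)"
    unfolding gas_rate_def invariant_tail_probabilities(1)[OF assms(7)] by (simp add: algebra_simps)
  moreover have "(gas_plus xs ys P \<gamma> \<delta> + gas_minus xs ys P \<gamma> \<delta>) / 2 = gas_G xs ys P \<gamma> \<delta>"
    by (simp add: gas_plus_def gas_minus_def gas_G_def add_divide_distrib mult.commute)
  ultimately have "gas_rate \<pi> xs ys P r \<gamma> \<delta> = gas_K \<sigma> \<gamma> \<delta> r * gas_G xs ys P \<gamma> \<delta>"
    by (simp add: invariant_tail_probabilities(2)[OF assms(7)])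
  moreover have "ys differentiable (at (P * exp (- \<gamma>)))" "ys differentiable (at (P * exp \<gamma>))"
    using \<open>P > 0\<close> ys[of "P * exp (- \<gamma>)"] ys[of "P * exp \<gamma>"]
    by (auto simp: real_differentiable_def)
  ultimately show ?thesis
    using gas_K_tendsto[OF assms(1,3,4)] gas_G_expansion[OF v xs ys assms(5)] by blast
qed

end
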